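(* Let $k\ge 2$ and $d\ge 1$ be integers, let $0<\theta<1$ be real with $d\theta>1$, and let $p\in(1,\infty)$ be determined by $d\theta=d^{1/p}$. Suppose that $Z$ is an infinite dimensional closed subspace of $T_k(d,\theta)$. Then there exists a closed subspace $Y\subseteq Z$ isomorphic to $\ell_p$.
   Context: Sequences and orders. $\omega=\{0,1,2,\dots\}$. For an integer $k\ge1$, $\omega^{\not\downarrow\le k}$ is the set of all non-decreasing finite sequences of elements of $\omega$ of length at most $k$ (including the empty sequence $()$), and $\omega^{\not\downarrow k}$ is the set of those of length exactly $k$. Write $s\sqsubset t$ if $s$ is a proper initial segment of $t$. Let $<_{\mathrm{lex}}$ be the lexicographic order in which a proper initial segment precedes the longer sequence. The well-order $\prec$ (of order type $\omega$) on $\omega^{\not\downarrow\le k}$ is: $()\prec s$ for all nonempty $s$; and for nonempty sequences, $(s_1,\dots,s_i)\prec(t_1,\dots,t_j)$ iff $s_i<t_j$, or $s_i=t_j$ and $(s_1,\dots,s_i)<_{\mathrm{lex}}(t_1,\dots,t_j)$. The spaces $\mathcal E_k$. An $\mathcal E_k$-tree is a function $\widehat X:\omega^{\not\downarrow\le k}\to\omega^{\not\downarrow\le k}$ preserving $\prec$ and $\sqsubset$ (hence preserving lengths). $\mathcal E_k$ is the collection of all sets $X=\widehat X[\omega^{\not\downarrow k}]$, for $\widehat X$ an $\mathcal E_k$-tree. For $X\in\mathcal E_k$ and $n\ge1$, $r_n(X)$ is the set of the $\prec$-least $n$ elements of $X$, and $\mathcal{AR}^k=\{r_n(X):X\in\mathcal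 E_k,\ n\ge1\}$. The Banach space $T_k(d,\theta)$. For nonempty finite $E,F\subset\omega^{\not\downarrow k}$, $E<F$ means $\max_\prec E\prec\min_\prec F$. Let $c_{00}(\omega^{\not\downarrow k})$ be the space of finitely supported functions $x:\omega^{\not\downarrow k}\to\mathbb R$, with canonical basis $(e_v)$, and $Ex=\sum_{v\in E}x_ve_v$. A sequence $(E_i)_{i=1}^m$ in $\mathcal{AR}^k$ is $d$-admissible if $m\le d$ and $E_1<\cdots<E_m$. Put $|x|_0=\max_v|x_v|$ and $|x|_{j+1}=\max\{|x|_j,\ \theta\max\{\sum_{i=1}^m|E_ix|_j:1\le m\le d,\ (E_i)_{i=1}^m\ d\text{-admissible}\}\}$, and $\|x\|=\sup_j|x|_j$. $T_k(d,\theta)$ is the completion of $c_{00}(\omega^{\not\downarrow k})$ in this norm. "Isomorphic" means linearly homeomorphic. *)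

theory Defs
  imports "HOL-Analysis.Analysis" "HOL-Library.Sublist"
begin

section \<open>Non-decreasing sequences and the spaces \<open>\<E>\<^sub>k\<close>\<close>

definition nondec_le :: "nat \<Rightarrow> nat list set" where
  "nondec_le k = {s. sorted s \<and> length s \<le> k}"

definition nondec_eq :: "nat \<Rightarrow> nat list set" where
  "nondec_eq k = {s. sorted s \<and> length s = k}"

text \<open>In \<^const>\<open>lexord\<close> a proper initial segment precedes the longer list.\<close>

definition prec :: "nat list \<Rightarrow> nat list \<Rightarrow> bool" where
  "prec s t \<longleftrightarrow> (s = [] \<and> t \<noteq> []) \<or>
     (s \<noteq> [] \<and> t \<noteq> [] \<and>
       (last s < last t \<or> (last s = last t \<and> (s, t) \<in> lexord less_than)))"

definition is_E_tree :: "nat \<Rightarrow> (nat list \<Rightarrow> nat list) \<Rightarrow> bool" where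
  "is_E_tree k X \<longleftrightarrow>
     (\<forall>s\<in>nondec_le k. X s \<in> nondec_le k) \<and>
     (\<forall>s\<in>nondec_le k. \<forall>t\<in>nondec_le k. prec s t \<longrightarrow> prec (X s) (X t)) \<and>
     (\<forall>s\<in>nondec_le k. \<forall>t\<in>nondec_le k. strict_prefix s t \<longrightarrow> strict_prefix (X s) (X t))"

definition E_space :: "nat \<Rightarrow> nat list set set" where
  "E_space k = {X ` nondec_eq k | X. is_E_tree k X}"

text \<open>The \<^const>\<open>prec\<close>-least \<open>n\<close> elements of \<open>X\<close> are those with fewer than \<open>n\<close> predecessors
  in \<open>X\<close>. For \<open>X \<subseteq> nondec_eq k\<close> the sets of predecessors are finite
  (\<open>finite_prec\<close> below), so \<^const>\<open>card\<close> does count them.\<close>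

definition r_approx :: "nat \<Rightarrow> nat list set \<Rightarrow> nat list set" where
  "r_approx n X = {s \<in> X. card {t \<in> X. prec t s} < n}"

definition AR :: "nat \<Rightarrow> nat list set set" where
  "AR k = {r_approx n X | n X. X \<in> E_space k \<and> n \<ge> 1}"

lemma finite_prec: "finite {t \<in> nondec_le k. prec t s}"
proof (rule finite_subset)
  show "finite {t. set t \<subseteq> {..last s} \<and> length t \<le> k}"
    by (rule finite_lists_length_le) simp
  have "y \<le> last t" if "sorted t" "y \<in> set t" for t :: "nat list" and y
    using that by (induction t) auto
  then show "{t \<in> nondec_le k. prec t s} \<subseteq> {t. set t \<subseteq> {..last s} \<and> length t \<le> k}"
    by (fastforce simp: nondec_le_def prec_def)
qed

section \<open>The norm of \<open>T\<^sub>k(d,\<theta>)\<close> on finitely supported functions\<close>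

text \<open>\<open>E < F\<close>, i.e. the maximum of \<open>E\<close> precedes the minimum of \<open>F\<close>.\<close>

definition set_prec :: "nat list set \<Rightarrow> nat list set \<Rightarrow> bool" where
  "set_prec E F \<longleftrightarrow> (\<exists>a\<in>E. \<exists>b\<in>F.
     (\<forall>e\<in>E. e = a \<or> prec e a) \<and> (\<forall>f\<in>F. f = b \<or> prec b f) \<and> prec a b)"

definition admissible :: "nat \<Rightarrow> nat \<Rightarrow> nat list set list \<Rightarrow> bool" where
  "admissible k d Es \<longleftrightarrow>
     1 \<le> length Es \<and> length Es \<le> d \<and> set Es \<subseteq> AR k \<and> sorted_wrt set_prec Es"

text \<open>The vectors of \<open>c\<^sub>0\<^sub>0(\<omega>\<^sup>k)\<close> are functions on all lists that vanish outside
  \<^term>\<open>nondec_eq k\<close>.\<close>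

definition c00 :: "nat \<Rightarrow> (nat list \<Rightarrow> real) set" where
  "c00 k = {x. finite {v. x v \<noteq> 0} \<and> {v. x v \<noteq> 0} \<subseteq> nondec_eq k}"

definition proj :: "nat list set \<Rightarrow> (nat list \<Rightarrow> real) \<Rightarrow> nat list \<Rightarrow> real" where
  "proj E x = (\<lambda>v. if v \<in> E then x v else 0)"

text \<open>For \<open>x \<in> c00 k\<close> both suprema below range over finite sets of reals (a finitely supported
  vector has only finitely many projections), so they are the maxima of the usual definition.\<close>

primrec T_norm_n :: "nat \<Rightarrow> nat \<Rightarrow> real \<Rightarrow> nat \<Rightarrow> (nat list \<Rightarrow> real) \<Rightarrow> real" where
  "T_norm_n k d \<theta> 0 = (\<lambda>x. SUP v\<in>nondec_eq k. \<bar>x v\<bar>)"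
| "T_norm_n k d \<theta> (Suc j) = (\<lambda>x. max (T_norm_n k d \<theta> j x)
     (\<theta> * (SUP Es\<in>{Es. admissible k d Es}. \<Sum>E\<leftarrow>Es. T_norm_n k d \<theta> j (proj E x))))"

definition T_norm :: "nat \<Rightarrow> nat \<Rightarrow> real \<Rightarrow> (nat list \<Rightarrow> real) \<Rightarrow> real" where
  "T_norm k d \<theta> x = (SUP j. T_norm_n k d \<theta> j x)"

lemma E_space_nonempty: "nondec_eq k \<in> E_space k"
proof -
  have "is_E_tree k id" by (simp add: is_E_tree_def)
  then show ?thesis unfolding E_space_def by (force intro: exI[of _ id])
qed

lemma set_prec_disjnt: "set_prec E F \<Longrightarrow> E \<inter> F = {}"
proof -
  have irrefl: "\<not> prec a a" for a by (auto simp: prec_def lexord_irreflexive)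
  have trans: "prec a c" if "prec a b" "prec b c" for a b c
  proof -
    have "(a, c) \<in> lexord less_than" if "(a, b) \<in> lexord less_than" "(b, c) \<in> lexord less_than"
      using that by (meson lexord_trans trans_less_than)
    then show ?thesis using that by (auto simp: prec_def)
  qed
  show "set_prec E F \<Longrightarrow> E \<inter> F = {}"
    unfolding set_prec_def using irrefl trans by (metis disjoint_iff)
qed

lemma proj_sum_le:
  assumes "finite S" "sorted_wrt set_prec Es"
  shows "(\<Sum>E\<leftarrow>Es. \<Sum>v\<in>S \<inter> E. \<bar>x v\<bar>) \<le> (\<Sum>v\<in>S. \<bar>x v :: real\<bar>)"
  using assms
proof (induction Es arbitrary: S)
  case Nil
  then show ?case by (simp add: sum_nonneg)
next
  case (Cons E Es)
  have "S \<inter> F = (S - E) \<inter> F" if "F \<in> set Es" for F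
    using Cons.prems that set_prec_disjnt[of E F] by auto
  then have "(\<Sum>F\<leftarrow>Es. \<Sum>v\<in>S \<inter> F. \<bar>x v\<bar>) = (\<Sum>F\<leftarrow>Es. \<Sum>v\<in>(S - E) \<inter> F. \<bar>x v\<bar>)"
    by (intro arg_cong[where f = sum_list] map_cong) auto
  also have "\<dots> \<le> (\<Sum>v\<in>S - E. \<bar>x v\<bar>)"
    using Cons by auto
  finally show ?case
    using sum.Int_Diff[of S "\<lambda>v. \<bar>x v\<bar>" E] Cons.prems by simp
qed

lemma T_norm_n_bounds:
  assumes "0 < \<theta>" "\<theta> < 1" "1 \<le> d" "x \<in> c00 k"
  shows "0 \<le> T_norm_n k d \<theta> j x \<and> T_norm_n k d \<theta> j x \<le> (\<Sum>v | x v \<noteq> 0. \<bar>x v\<bar>)"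
  using assms(4)
proof (induction j arbitrary: x)
  case 0
  let ?S = "\<Sum>v | x v \<noteq> 0. \<bar>x v\<bar>"
  have ub: "\<bar>x v\<bar> \<le> ?S" for v
    using 0 member_le_sum[of v "{v. x v \<noteq> 0}" "\<lambda>v. \<bar>x v\<bar>"]
    by (cases "x v = 0") (auto simp: c00_def sum_nonneg)
  have v0: "replicate k 0 \<in> nondec_eq k" by (simp add: nondec_eq_def)
  have "0 \<le> \<bar>x (replicate k 0)\<bar>" by simp
  also have "\<dots> \<le> (SUP v\<in>nondec_eq k. \<bar>x v\<bar>)"
    using v0 ub by (intro cSUP_upper) (auto intro!: bdd_aboveI[of _ ?S])
  finally show ?case using ub v0 by (auto intro!: cSUP_least)
next
  case (Suc j)
  let ?S = "\<Sum>v | x v \<noteq> 0. \<bar>x v\<bar>"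
  let ?A = "{Es. admissible k d Es}"
  let ?M = "SUP Es\<in>?A. \<Sum>E\<leftarrow>Es. T_norm_n k d \<theta> j (proj E x)"
  have "r_approx 1 (nondec_eq k) \<in> AR k"
    unfolding AR_def using E_space_nonempty by auto
  then have "[r_approx 1 (nondec_eq k)] \<in> ?A"
    using assms by (auto simp: admissible_def)
  then have ne: "?A \<noteq> {}" by blast
  have "(\<Sum>E\<leftarrow>Es. T_norm_n k d \<theta> j (proj E x)) \<le> ?S" if "Es \<in> ?A" for Es
  proof -
    have "T_norm_n k d \<theta> j (proj E x) \<le> (\<Sum>v\<in>{v. x v \<noteq> 0} \<inter> E. \<bar>x v\<bar>)" for E
    proof -
      have eq: "{v. proj E x v \<noteq> 0} = {v. x v \<noteq> 0} \<inter> E" by (auto simp: proj_def)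
      then have "proj E x \<in> c00 k" using Suc.prems by (auto simp: c00_def)
      from Suc.IH[OF this] show ?thesis unfolding eq by (simp add: proj_def)
    qed
    then have "(\<Sum>E\<leftarrow>Es. T_norm_n k d \<theta> j (proj E x))
        \<le> (\<Sum>E\<leftarrow>Es. \<Sum>v\<in>{v. x v \<noteq> 0} \<inter> E. \<bar>x v\<bar>)"
      by (intro sum_list_mono) auto
    also have "\<dots> \<le> ?S"
      using Suc.prems that by (intro proj_sum_le) (auto simp: c00_def admissible_def)
    finally show ?thesis .
  qed
  then have "?M \<le> ?S" using ne by (intro cSUP_least)
  then have "\<theta> * ?M \<le> \<theta> * ?S" using assms by simp
  also have "\<dots> \<le> ?S" using assms by (simp add: mult_left_le_one_le sum_nonneg)
  finally have "\<theta> * ?M \<le> ?S" .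
  then show ?case using Suc.IH[OF Suc.prems] by (simp add: le_max_iff_disj)
qed

section \<open>Completions\<close>

text \<open>\<open>T_k(d,\<theta>)\<close> depends on real parameters, so it cannot be a type. A completion is therefore
  presented as a closed set \<open>T\<close> of vectors of an ambient Banach space \<open>'b\<close>, together with a linear
  isometry \<open>J\<close> of the given normed space \<open>(V, N)\<close> onto a dense subset of \<open>T\<close>. It is unique up to
  isometric isomorphism. One ambient type serves all parameters: \<open>T_k(d,\<theta>)\<close> is separable, and
  every separable Banach space embeds isometrically into \<open>\<ell>\<^sub>\<infinity>\<close>.\<close>

definition is_completion ::
  "(nat list \<Rightarrow> real) set \<Rightarrow> ((nat list \<Rightarrow> real) \<Rightarrow> real) \<Rightarrow>
   ((nat list \<Rightarrow> real) \<Rightarrow> 'b::banach) \<Rightarrow> 'b set \<Rightarrow> bool" where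
  "is_completion V N J T \<longleftrightarrow>
     (\<forall>x\<in>V. \<forall>y\<in>V. J (\<lambda>v. x v + y v) = J x + J y) \<and>
     (\<forall>c. \<forall>x\<in>V. J (\<lambda>v. c * x v) = c *\<^sub>R J x) \<and>
     (\<forall>x\<in>V. norm (J x) = N x) \<and>
     T = closure (J ` V)"

definition is_T_space ::
  "nat \<Rightarrow> nat \<Rightarrow> real \<Rightarrow> ((nat list \<Rightarrow> real) \<Rightarrow> 'b::banach) \<Rightarrow> 'b set \<Rightarrow> bool" where
  "is_T_space k d \<theta> J T \<longleftrightarrow> is_completion (c00 k) (T_norm k d \<theta>) J T"

definition infinite_dimensional :: "'b::real_vector set \<Rightarrow> bool" where
  "infinite_dimensional Z \<longleftrightarrow> \<not> (\<exists>B. finite B \<and> Z \<subseteq> span B)"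

section \<open>The space \<open>\<ell>\<^sub>p\<close>\<close>

definition lp :: "real \<Rightarrow> (nat \<Rightarrow> real) set" where
  "lp p = {a. summable (\<lambda>n. \<bar>a n\<bar> powr p)}"

definition lp_norm :: "real \<Rightarrow> (nat \<Rightarrow> real) \<Rightarrow> real" where
  "lp_norm p a = (\<Sum>n. \<bar>a n\<bar> powr p) powr (1 / p)"

definition lp_topology :: "real \<Rightarrow> (nat \<Rightarrow> real) topology" where
  "lp_topology p = Metric_space.mtopology (lp p) (\<lambda>a b. lp_norm p (\<lambda>n. a n - b n))"

definition isomorphic_to_lp :: "real \<Rightarrow> 'b::real_normed_vector set \<Rightarrow> bool" where
  "isomorphic_to_lp p Y \<longleftrightarrow> (\<exists>U.
     (\<forall>a\<in>lp p. \<forall>b\<in>lp p. U (\<lambda>n. a n + b n) = U a + U b) \<and>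
     (\<forall>c. \<forall>a\<in>lp p. U (\<lambda>n. c * a n) = c *\<^sub>R U a) \<and>
     homeomorphic_map (lp_topology p) (top_of_set Y) U)"

lemma powr_convex_nonneg:
  fixes x y u p :: real
  assumes "1 \<le> p" "0 \<le> x" "0 \<le> y" "0 < u" "u < 1"
  shows "(u * x + (1 - u) * y) powr p \<le> u * x powr p + (1 - u) * y powr p"
proof -
  have small: "w powr p \<le> w" if "0 < w" "w < 1" for w :: real
    using powr_mono'[of 1 p w] assms that by simp
  consider "x = 0" | "y = 0" | "0 < x" "0 < y" using assms by linarith
  then show ?thesis
  proof cases
    case 1
    then show ?thesis
      using assms small[of "1 - u"] by (simp add: powr_mult mult_right_mono)
  next
    case 2
    then show ?thesis
      using assms small[of u] by (simp add: powr_mult mult_right_mono)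
  next
    case 3
    then show ?thesis
      using convex_onD[OF powr_convex[OF assms(1)], of "1 - u" x y] assms by simp
  qed
qed

lemma lp_norm_eq_0:
  assumes "0 < p" "a \<in> lp p"
  shows "lp_norm p a = 0 \<longleftrightarrow> (\<forall>n. a n = 0)"
proof -
  have "(\<Sum>n. \<bar>a n\<bar> powr p) = 0 \<longleftrightarrow> (\<forall>n. \<bar>a n\<bar> powr p = 0)"
    using assms by (intro suminf_eq_zero_iff) (auto simp: lp_def)
  then show ?thesis by (simp add: lp_norm_def)
qed

lemma lp_norm_powr:
  assumes "0 < p" "a \<in> lp p"
  shows "lp_norm p a powr p = (\<Sum>n. \<bar>a n\<bar> powr p)"
  using assms by (simp add: lp_norm_def powr_powr lp_def suminf_nonneg)

lemma lp_triangle: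
  assumes p: "1 \<le> p" and a: "a \<in> lp p" and b: "b \<in> lp p"
  shows "(\<lambda>n. a n + b n) \<in> lp p"
    and "lp_norm p (\<lambda>n. a n + b n) \<le> lp_norm p a + lp_norm p b"
proof -
  define A where "A = lp_norm p a"
  define B where "B = lp_norm p b"
  have nn: "0 \<le> A" "0 \<le> B" by (auto simp: A_def B_def lp_norm_def)
  have "(\<lambda>n. a n + b n) \<in> lp p \<and> lp_norm p (\<lambda>n. a n + b n) \<le> A + B"
  proof (cases "A = 0 \<or> B = 0")
    case True
    then have "(\<forall>n. a n = 0) \<or> (\<forall>n. b n = 0)"
      using lp_norm_eq_0[of p a] lp_norm_eq_0[of p b] p a b by (auto simp: A_def B_def)
    then show ?thesis using a b nn by (auto simp: A_def B_def)
  next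
    case False
    then have pos: "0 < A" "0 < B" using nn by auto
    define u where "u = A / (A + B)"
    have u: "0 < u" "u < 1" using pos by (auto simp: u_def)
    have uA: "(A + B) * u = A" "(A + B) * (1 - u) = B"
      using pos by (auto simp: u_def field_simps)
    define f where "f = (\<lambda>n. (A + B) powr p *
      (u * (\<bar>a n\<bar> powr p / A powr p) + (1 - u) * (\<bar>b n\<bar> powr p / B powr p)))"
    have le: "\<bar>a n + b n\<bar> powr p \<le> f n" for n
    proof -
      have "\<bar>a n + b n\<bar> \<le> \<bar>a n\<bar> + \<bar>b n\<bar>" by simp
      also have "\<dots> = (A + B) * (u * (\<bar>a n\<bar> / A) + (1 - u) * (\<bar>b n\<bar> / B))"
        unfolding distrib_left mult.assoc[symmetric] uA using pos by simp
      finally have "\<bar>a n + b n\<bar> powr p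
          \<le> ((A + B) * (u * (\<bar>a n\<bar> / A) + (1 - u) * (\<bar>b n\<bar> / B))) powr p"
        using p by (intro powr_mono2) auto
      also have "\<dots> = (A + B) powr p * (u * (\<bar>a n\<bar> / A) + (1 - u) * (\<bar>b n\<bar> / B)) powr p"
        by (rule powr_mult)
      also have "\<dots> \<le> (A + B) powr p *
          (u * (\<bar>a n\<bar> / A) powr p + (1 - u) * (\<bar>b n\<bar> / B) powr p)"
        using pos u p by (intro mult_left_mono powr_convex_nonneg) auto
      also have "\<dots> = f n" using pos by (simp add: f_def powr_divide)
      finally show ?thesis .
    qed
    have sa: "(\<lambda>n. \<bar>a n\<bar> powr p) sums (A powr p)"
      using a p lp_norm_powr[of p a] by (simp add: A_def lp_def summable_sums)
    have sb: "(\<lambda>n. \<bar>b n\<bar> powr p) sums (B powr p)"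
      using b p lp_norm_powr[of p b] by (simp add: B_def lp_def summable_sums)
    have "f sums ((A + B) powr p *
        (u * (A powr p / A powr p) + (1 - u) * (B powr p / B powr p)))"
      unfolding f_def by (intro sums_mult sums_add sums_divide sa sb)
    then have f: "f sums ((A + B) powr p)" using pos by simp
    have s: "summable (\<lambda>n. \<bar>a n + b n\<bar> powr p)"
      using le by (intro summable_comparison_test'[OF sums_summable[OF f]]) auto
    have "(\<Sum>n. \<bar>a n + b n\<bar> powr p) \<le> (A + B) powr p"
      using suminf_le[OF le s sums_summable[OF f]] sums_unique[OF f] by simp
    then have "lp_norm p (\<lambda>n. a n + b n) \<le> ((A + B) powr p) powr (1 / p)"
      unfolding lp_norm_def using p s by (intro powr_mono2) (auto simp: suminf_nonneg)
    then show ?thesis using s p pos by (simp add: lp_def powr_powr)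
  qed
  then show "(\<lambda>n. a n + b n) \<in> lp p"
    and "lp_norm p (\<lambda>n. a n + b n) \<le> lp_norm p a + lp_norm p b"
    by (auto simp: A_def B_def)
qed

lemma Metric_space_lp:
  assumes p: "1 \<le> p"
  shows "Metric_space (lp p) (\<lambda>a b. lp_norm p (\<lambda>n. a n - b n))"
proof -
  have diff: "(\<lambda>n. a n - b n) \<in> lp p" if "a \<in> lp p" "b \<in> lp p" for a b
    using lp_triangle(1)[OF p that(1), of "\<lambda>n. - b n"] that by (simp add: lp_def)
  show ?thesis
  proof
    fix a b c :: "nat \<Rightarrow> real"
    show "0 \<le> lp_norm p (\<lambda>n. a n - b n)" by (simp add: lp_norm_def)
    show "lp_norm p (\<lambda>n. a n - b n) = lp_norm p (\<lambda>n. b n - a n)"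
      by (simp add: lp_norm_def abs_minus_commute)
    assume ab: "a \<in> lp p" "b \<in> lp p"
    show "lp_norm p (\<lambda>n. a n - b n) = 0 \<longleftrightarrow> a = b"
      using lp_norm_eq_0[OF _ diff[OF ab]] p by (auto simp: fun_eq_iff)
    assume c: "c \<in> lp p"
    show "lp_norm p (\<lambda>n. a n - c n) \<le> lp_norm p (\<lambda>n. a n - b n) + lp_norm p (\<lambda>n. b n - c n)"
      using lp_triangle(2)[OF p diff[OF ab] diff[OF ab(2) c]] by simp
  qed
qed

end

theory Submission
  imports Defs
begin

text \<open>The upper \<open>p\<close>-estimate holds for all block sequences, by induction on the recursive
  definition of the norm. A lower \<open>p\<close>-estimate needs admissible sequences that separate the
  blocks. The sets of \<open>\<A>\<R>\<^sup>k\<close> can do this for blocks which live above a fixed node \<open>s\<close> of the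
  tree and whose next coordinates, after \<open>s\<close>, eventually exceed any bound, because
  \<open>{v. s \<sqsubseteq> v, v\<^sub>\<ell> \<ge> N}\<close>, with \<open>\<ell>\<close> the length of \<open>s\<close>, is contained in a member of \<open>\<E>\<^sub>k\<close>
  whose least element ends in \<open>N\<close>. Given
  normalized blocks \<open>x\<^sub>n\<close> close to \<open>Z\<close>, such an \<open>s\<close> is a longest node for which the restrictions
  of \<open>x\<^sub>n\<close> to \<open>{v. s \<sqsubseteq> v}\<close> do not tend to \<open>0\<close> in norm; since the basis is \<open>1\<close>-unconditional,
  the lower estimate passes from these restrictions to a subsequence of \<open>x\<^sub>n\<close>.\<close>

section \<open>Finite sums and $p$-th powers\<close>

text \<open>For non-negative b the l_p-norm is the supremum of the sums of b_i w_i^(1 - 1/p) over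
  weights w of total at most 1. The relation \<theta> d^(1 - 1/p) = 1 says that dividing the weights
  by d multiplies such a sum by exactly \<theta>, the factor that the norm charges for one splitting
  into d sets. Both estimates distribute weights in this way, so that no constant is lost at each
  level of the recursion.

  The obstacle to a lower estimate: an \<E>_k-tree sends every node with positive last entry to a
  node ending at or beyond N, the last entry of the image of (0,...,0). So each element of a member
  of \<E>_k follows the least element up to some position and has entries at least N from there on.
  A set that begins late thus sees only one branch through the small numbers and cannot cover a
  block spread over many of them. Fixing a single node \<open>s\<close> confines the block to one
  branch; the price is that only a restriction of the block is estimated, which must keep a norm
  bounded away from 0.\<close>

definition pnorm :: "real \<Rightarrow> ('a \<Rightarrow> real) \<Rightarrow> 'a set \<Rightarrow> real" where
  "pnorm p a I = (\<Sum>i\<in>I. \<bar>a i\<bar> powr p) powr (1 / p)"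

lemma pnorm_nonneg [simp]: "0 \<le> pnorm p a I"
  by (simp add: pnorm_def)

lemma pnorm_powr: "0 < p \<Longrightarrow> pnorm p a I powr p = (\<Sum>i\<in>I. \<bar>a i\<bar> powr p)"
  by (simp add: pnorm_def powr_powr sum_nonneg)

lemma abs_le_pnorm:
  assumes "0 < p" "finite I" "i \<in> I"
  shows "\<bar>a i\<bar> \<le> pnorm p a I"
proof -
  have "\<bar>a i\<bar> = (\<bar>a i\<bar> powr p) powr (1 / p)" using assms by (simp add: powr_powr)
  also have "\<dots> \<le> pnorm p a I"
    unfolding pnorm_def using assms
    by (intro powr_mono2 member_le_sum) auto
  finally show ?thesis .
qed

lemma pnorm_mono:
  assumes "0 < p" "\<And>i. i \<in> I \<Longrightarrow> \<bar>a i\<bar> \<le> \<bar>b i\<bar>"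
  shows "pnorm p a I \<le> pnorm p b I"
  unfolding pnorm_def using assms by (intro powr_mono2 sum_mono sum_nonneg) auto

lemma pnorm_cmult:
  assumes "0 < p"
  shows "pnorm p (\<lambda>i. c * a i) I = \<bar>c\<bar> * pnorm p a I"
proof -
  have "(\<Sum>i\<in>I. \<bar>c * a i\<bar> powr p) = \<bar>c\<bar> powr p * (\<Sum>i\<in>I. \<bar>a i\<bar> powr p)"
    by (simp add: abs_mult powr_mult sum_distrib_left)
  then show ?thesis
    using assms by (simp add: pnorm_def powr_mult powr_powr)
qed

text \<open>Hoelder's inequality: for the conjugate exponent q, the numbers
  \<open>w i powr (1 - 1 / p)\<close> have l_q-norm at most 1. It is phrased with weights because
  weights coming from different sets can simply be added up.\<close>

lemma sum_mult_powr_le_pnorm: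
  fixes p :: real
  assumes p: "1 < p" and I: "finite I" and w: "\<And>i. i \<in> I \<Longrightarrow> 0 \<le> w i" "(\<Sum>i\<in>I. w i) \<le> 1"
  shows "(\<Sum>i\<in>I. b i * w i powr (1 - 1 / p)) \<le> pnorm p b I"
proof -
  let ?q = "p / (p - 1)" and ?B = "pnorm p b I"
  have q: "?q > 1" "1 / p + 1 / ?q = 1" "(1 - 1/p) * ?q = 1" using p by (auto simp: field_simps)
  show ?thesis
  proof (cases "?B = 0")
    case True
    then have "b i = 0" if "i \<in> I" for i using abs_le_pnorm[of p I i b] p I that by auto
    then show ?thesis by simp
  next
    case False
    then have B: "?B > 0" using pnorm_nonneg[of p b I] by linarith
    have "(\<Sum>i\<in>I. b i * w i powr (1 - 1 / p)) \<le> (\<Sum>i\<in>I. ?B * ((\<bar>b i\<bar> powr p / ?B powr p) / p + w i / ?q))"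
    proof (rule sum_mono)
      fix i assume i: "i \<in> I"
      have "(\<bar>b i\<bar> / ?B) * (w i powr (1 - 1/p))
          \<le> (\<bar>b i\<bar> / ?B) powr p / p + (w i powr (1 - 1/p)) powr ?q / ?q"
        using p q B by (intro Youngs_inequality) auto
      also have "(w i powr (1 - 1/p)) powr ?q = w i"
        using w(1)[OF i] by (simp only: powr_powr q(3)) simp
      also have "(\<bar>b i\<bar> / ?B) powr p = \<bar>b i\<bar> powr p / ?B powr p" by (simp add: powr_divide)
      finally have "?B * ((\<bar>b i\<bar> / ?B) * (w i powr (1 - 1/p))) \<le> ?B * (\<bar>b i\<bar> powr p / ?B powr p / p + w i / ?q)"
        using B by (intro mult_left_mono) auto
      moreover have "b i * w i powr (1 - 1/p) \<le> ?B * ((\<bar>b i\<bar> / ?B) * (w i powr (1 - 1/p)))"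
        using B by (simp add: mult_right_mono)
      ultimately show "b i * w i powr (1 - 1 / p) \<le> ?B * ((\<bar>b i\<bar> powr p / ?B powr p) / p + w i / ?q)"
        by linarith
    qed
    also have "\<dots> = ?B * ((\<Sum>i\<in>I. \<bar>b i\<bar> powr p) / ?B powr p / p + (\<Sum>i\<in>I. w i) / ?q)"
      by (simp only: sum_distrib_left[symmetric] sum.distrib sum_divide_distrib[symmetric])
    also have "(\<Sum>i\<in>I. \<bar>b i\<bar> powr p) / ?B powr p = 1"
      using B p by (simp flip: pnorm_powr)
    also have "?B * (1 / p + (\<Sum>i\<in>I. w i) / ?q) \<le> ?B * (1 / p + 1 / ?q)"
      using B q w(2) by (intro mult_left_mono add_left_mono divide_right_mono) auto
    finally show ?thesis using q by simp
  qed
qed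

text \<open>The equality case of Hoelder's inequality, with weights proportional to the p-th powers
  of b. They turn the p-norm of a group of blocks into a sum that can be regrouped block by
  block.\<close>

lemma pnorm_dual_weights:
  fixes p :: real
  assumes p: "1 < p" and "\<And>i. i \<in> I \<Longrightarrow> 0 \<le> b i"
  obtains w where "\<And>i. 0 \<le> w i" "(\<Sum>i\<in>I. w i) \<le> 1"
    "(\<Sum>i\<in>I. b i * w i powr (1 - 1 / p)) = pnorm p b I"
proof (cases "pnorm p b I = 0")
  case True
  then show ?thesis by (intro that[of "\<lambda>_. 0"]) auto
next
  case False
  let ?B = "pnorm p b I"
  have B: "?B > 0" using False pnorm_nonneg[of p b I] by linarith
  let ?w = "\<lambda>i. \<bar>b i\<bar> powr p / ?B powr p"
  have S: "(\<Sum>i\<in>I. \<bar>b i\<bar> powr p) = ?B powr p" using p by (simp add: pnorm_powr)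
  have "b i * ?w i powr (1 - 1 / p) = \<bar>b i\<bar> powr p / ?B powr (p - 1)" if "i \<in> I" for i
  proof (cases "b i = 0")
    case False
    then have "b i > 0" using assms(2)[OF that] by simp
    moreover have "p * (1 - 1/p) = p - 1" using p by (simp add: field_simps)
    moreover have "b i * b i powr (p - 1) = b i powr p"
      using \<open>b i > 0\<close> by (simp add: powr_diff)
    ultimately show ?thesis
      using B p by (simp add: powr_divide powr_powr)
  qed (use p in auto)
  then have "(\<Sum>i\<in>I. b i * ?w i powr (1 - 1 / p)) = ?B powr p / ?B powr (p - 1)"
    by (simp add: S flip: sum_divide_distrib)
  also have "\<dots> = ?B" using B by (simp add: powr_diff)
  finally show ?thesis
    using B S by (intro that[of ?w]) (auto simp flip: sum_divide_distrib)
qed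

text \<open>(1 + w)^r - w^r is continuous and positive on the compact interval [0,1], hence has a
  positive minimum. Times a large constant, this margin later pays for a whole block.\<close>

lemma powr_gap:
  fixes r :: real
  assumes "0 < r"
  obtains \<kappa> where "0 < \<kappa>" "\<And>w. 0 \<le> w \<Longrightarrow> w \<le> 1 \<Longrightarrow> w powr r + \<kappa> \<le> (1 + w) powr r"
proof -
  have c: "continuous_on {0..1::real} (\<lambda>w. (1 + w) powr r - w powr r)"
    using assms by (intro continuous_on_diff continuous_on_powr' continuous_intros) auto
  obtain w0 :: real where w0: "w0 \<in> {0..1}" 
    "\<And>w. w \<in> {0..1} \<Longrightarrow> (1 + w0) powr r - w0 powr r \<le> (1 + w) powr r - w powr r"
    using continuous_attains_inf[OF _ _ c] by auto
  have "w0 powr r < (1 + w0) powr r" using w0 assms by (intro powr_less_mono2) auto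
  then show ?thesis using w0 by (intro that[of "(1 + w0) powr r - w0 powr r"]) force+
qed

section \<open>Lower $p$-estimates from superadditivity\<close>

text \<open>Shannon--Fano--Elias coding: the points \<open>t i\<close> are the midpoints of consecutive intervals
  of length \<open>b i\<close>, and a \<open>d\<close>-adic interval of length at most \<open>b i / 2\<close> around \<open>t i\<close> contains no
  other of these points. Splitting \<open>d\<close>-adically therefore isolates \<open>i\<close> after \<open>n i\<close> steps with
  \<open>d ^ n i\<close> comparable to \<open>1 / b i\<close>.\<close>

lemma pnorm_le_superadditive:
  fixes \<phi> :: "nat set \<Rightarrow> real" and a :: "nat \<Rightarrow> real"
  assumes p: "1 < p" and d: "2 \<le> d" and \<theta>: "0 < \<theta>" "\<theta> \<le> 1" "\<theta> * real d powr (1 - 1 / p) = 1"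
    and I: "finite I" and \<phi>0: "0 \<le> \<phi> {}" and mono: "\<And>A B. A \<subseteq> B \<Longrightarrow> B \<subseteq> I \<Longrightarrow> \<phi> A \<le> \<phi> B"
    and single: "\<And>i. i \<in> I \<Longrightarrow> \<bar>a i\<bar> \<le> \<phi> {i}"
    and super: "\<And>f. (\<And>l. l < d \<Longrightarrow> f l \<subseteq> I) \<Longrightarrow>
      (\<And>l l' i i'. l < l' \<Longrightarrow> l' < d \<Longrightarrow> i \<in> f l \<Longrightarrow> i' \<in> f l' \<Longrightarrow> i < i') \<Longrightarrow>
      \<theta> * (\<Sum>l<d. \<phi> (f l)) \<le> \<phi> (\<Union>l<d. f l)"
  shows "(1 / (2 * real d)) powr (1 - 1 / p) * pnorm p a I \<le> \<phi> I"
proof -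
  let ?r = "1 - 1 / p"
  have r: "0 < ?r" using p by simp
  obtain b where b: "\<And>i. 0 \<le> b i" "(\<Sum>i\<in>I. b i) \<le> 1"
    "(\<Sum>i\<in>I. \<bar>a i\<bar> * b i powr ?r) = pnorm p (\<lambda>i. \<bar>a i\<bar>) I"
    using pnorm_dual_weights[OF p, of I "\<lambda>i. \<bar>a i\<bar>"] by auto
  have ba: "(\<Sum>i\<in>I. \<bar>a i\<bar> * b i powr ?r) = pnorm p a I" using b(3) by (simp add: pnorm_def)
  \<comment> \<open>An index of weight 0 has no code interval; dropping it is harmless because
    \<phi> is monotone and its term in the dual sum is 0.\<close>
  define I' where "I' = {i \<in> I. b i > 0}"
  have I': "I' \<subseteq> I" "finite I'" using I by (auto simp: I'_def)
  define t where "t i = (\<Sum>j\<in>{j\<in>I. j < i}. b j) + b i / 2" for i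
  have t_gap: "b i / 2 + b i' / 2 \<le> t i' - t i" if "i \<in> I" "i < i'" for i i'
  proof -
    have "(\<Sum>j\<in>{j\<in>I. j < i}. b j) + b i = (\<Sum>j\<in>insert i {j\<in>I. j < i}. b j)" using I by simp
    also have "\<dots> \<le> (\<Sum>j\<in>{j\<in>I. j < i'}. b j)"
      using that I b by (intro sum_mono2) auto
    finally show ?thesis by (simp add: t_def)
  qed
  have t0: "0 \<le> t i" for i using b by (auto simp: t_def intro!: add_nonneg_nonneg sum_nonneg)
  have t1: "t i < 1" if "i \<in> I'" for i
  proof -
    have "(\<Sum>j\<in>{j\<in>I. j < i}. b j) + b i = (\<Sum>j\<in>insert i {j\<in>I. j < i}. b j)" using I by simp
    also have "\<dots> \<le> (\<Sum>j\<in>I. b j)" using that I b I' by (intro sum_mono2) auto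
    finally show ?thesis using b(2) that by (simp add: t_def I'_def)
  qed
  define h where "h m = (1 / real d) ^ m" for m
  have h: "0 < h m" "h (Suc m) = h m / d" for m using d by (auto simp: h_def)
  have h_anti: "h m \<le> h n" if "n \<le> m" for m n
    unfolding h_def using d that by (intro power_decreasing) auto
  define n where "n i = (LEAST n. h n \<le> b i / 2)" for i
  have n: "h (n i) \<le> b i / 2" "b i / (2 * d) < h (n i)" if "i \<in> I'" for i
  proof -
    have "\<exists>n. (1 / real d) ^ n < b i / 2" using that d by (intro real_arch_pow_inv) (auto simp: I'_def)
    then have "\<exists>n. h n \<le> b i / 2" by (auto simp: h_def intro: less_imp_le)
    then show 1: "h (n i) \<le> b i / 2" unfolding n_def by (rule LeastI_ex)
    \<comment> \<open>As \<open>b i\<close> is at most 1, the interval of length 1 is too long, so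
      \<open>n i\<close> has a predecessor; minimality fails there by at most a factor d. This is
      the source of the constant 1 / (2 d).\<close>
    have "b i \<le> (\<Sum>j\<in>I. b j)" using that I I' b by (intro member_le_sum) auto
    then have "n i \<noteq> 0" using 1 b(2) by (intro notI) (simp add: h_def)
    then obtain q where q: "n i = Suc q" using not0_implies_Suc by blast
    then have "\<not> h q \<le> b i / 2" unfolding n_def using not_less_Least[of q] by (metis lessI n_def q)
    then show "b i / (2 * d) < h (n i)" using d by (simp add: q h divide_strict_right_mono field_simps)
  qed
  obtain K where K: "\<And>i. i \<in> I' \<Longrightarrow> n i \<le> K"
    using finite_nat_set_iff_bounded_le[of "n ` I'"] I' by auto
  define J where "J m s = {i \<in> I'. s \<le> t i \<and> t i < s + h m}" for m s
  \<comment> \<open>Every splitting of a d-adic interval costs one factor \<theta>. A lone index may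
    be reached before its own level: m \<le> \<open>n i\<close> and \<theta> \<le> 1 make this
    favourable.\<close>
  have main: "(\<Sum>i\<in>J m s. \<theta> ^ n i * \<bar>a i\<bar>) \<le> \<theta> ^ m * \<phi> (J m s)" if "\<forall>i\<in>J m s. m \<le> n i" for m s
    using that
  proof (induction "K - m" arbitrary: m s rule: less_induct)
    case less
    have finJ: "finite (J m s)" using I' by (auto simp: J_def)
    have JI: "J m s \<subseteq> I" using I' by (auto simp: J_def)
    consider "card (J m s) = 0" | "card (J m s) = 1" | "2 \<le> card (J m s)" by linarith
    then show ?case
    proof cases
      case 1
      then show ?thesis using finJ \<phi>0 \<theta> by simp
    next
      case 2
      then obtain i where i: "J m s = {i}" by (auto simp: card_1_singleton_iff)
      then have "i \<in> I" "m \<le> n i" using JI less.prems by auto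
      then have "\<theta> ^ n i * \<bar>a i\<bar> \<le> \<theta> ^ m * \<phi> {i}"
        using \<theta> single by (intro mult_mono power_decreasing) auto
      then show ?thesis by (simp add: i)
    next
      case 3
      \<comment> \<open>Two code points in one interval of length \<open>h m\<close> are closer than
        \<open>h m\<close>, yet at least \<open>b i / 2\<close> apart. So level m is still above the
        level of every index here, and one more splitting is affordable.\<close>
      have lt: "m < n i" if i: "i \<in> J m s" for i
      proof -
        have "\<exists>i'\<in>J m s. i' \<noteq> i"
        proof (rule ccontr)
          assume "\<not> ?thesis"
          then have "J m s \<subseteq> {i}" by auto
          then have "card (J m s) \<le> 1" using card_mono[of "{i}" "J m s"] by simp
          then show False using 3 by simp
        qed
        then obtain i' where i': "i' \<in> J m s" "i' \<noteq> i" by blast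
        then have iI: "i \<in> I" "i' \<in> I" using i JI by auto
        have "b i / 2 \<le> \<bar>t i' - t i\<bar>"
          using t_gap[OF iI(1), of i'] t_gap[OF iI(2), of i] i' b(1)[of i] b(1)[of i']
          by (cases i i' rule: linorder_cases) auto
        also have "\<dots> < h m" using i i' by (auto simp: J_def)
        finally have "b i / 2 < h m" .
        show "m < n i"
        proof (rule ccontr)
          assume "\<not> m < n i"
          then have "h m \<le> h (n i)" by (intro h_anti) simp
          then show False using n(1)[of i] \<open>b i / 2 < h m\<close> i by (auto simp: J_def)
        qed
      qed
      obtain i0 where "i0 \<in> J m s" using 3 by (cases "J m s = {}") auto
      then have mK: "m < K" using lt K[of i0] by (fastforce simp: J_def)
      define f where "f l = J (Suc m) (s + real l * h (Suc m))" for l :: nat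
      have fI: "f l \<subseteq> I" and finf: "finite (f l)" for l using I' by (auto simp: f_def J_def)
      have tsep: "t i < t i'" if "l < l'" "i \<in> f l" "i' \<in> f l'" for l l' i i'
      proof -
        have "t i < s + (real l + 1) * h (Suc m)" using that by (simp add: f_def J_def algebra_simps)
        also have "\<dots> \<le> s + real l' * h (Suc m)"
          using that h(1)[of "Suc m"] by (intro add_left_mono mult_right_mono) auto
        also have "\<dots> \<le> t i'" using that by (simp add: f_def J_def)
        finally show ?thesis .
      qed
      have ord: "i < i'" if "l < l'" "i \<in> f l" "i' \<in> f l'" for l l' i i'
      proof (rule ccontr)
        assume "\<not> i < i'"
        then have "t i' \<le> t i"
          using t_gap[of i' i] b(1)[of i] b(1)[of i'] that fI[of l'] by (cases "i = i'") auto
        then show False using tsep[OF that] by simp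
      qed
      have U: "(\<Union>l<d. f l) = J m s"
      proof (intro equalityI subsetI)
        fix i assume "i \<in> (\<Union>l<d. f l)"
        then obtain l where l: "l < d" "i \<in> f l" by auto
        then have "i \<in> I'" and ti: "s + real l * h (Suc m) \<le> t i" "t i < s + (real l + 1) * h (Suc m)"
          by (auto simp: f_def J_def algebra_simps)
        have "0 \<le> real l * h (Suc m)" using h(1)[of "Suc m"] by simp
        then have "s \<le> t i" using ti by linarith
        moreover
        have "(real l + 1) * h (Suc m) \<le> real d * h (Suc m)"
          using l h(1)[of "Suc m"] by (intro mult_right_mono) auto
        moreover have "real d * h (Suc m) = h m" using d by (simp add: h)
        ultimately show "i \<in> J m s" using \<open>i \<in> I'\<close> ti by (simp add: J_def)
      next
        fix i assume i: "i \<in> J m s"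
        define u where "u = (t i - s) / h (Suc m)"
        have tu: "t i = s + u * h (Suc m)" using h(1)[of "Suc m"] by (simp add: u_def)
        have "0 \<le> u" using i h(1)[of "Suc m"] by (simp add: u_def J_def)
        have "u * h (Suc m) < real d * h (Suc m)" using i tu d by (simp add: J_def h)
        then have "u < d" using h(1)[of "Suc m"] by simp
        define l where "l = nat \<lfloor>u\<rfloor>"
        have l: "real l \<le> u" "u < real l + 1" using \<open>0 \<le> u\<close> by (auto simp: l_def)
        then have "l < d" using \<open>u < d\<close> by linarith
        moreover have "real l * h (Suc m) \<le> u * h (Suc m)" "u * h (Suc m) < (real l + 1) * h (Suc m)"
          using l h(1)[of "Suc m"] by auto
        then have "i \<in> f l" using i tu by (simp add: f_def J_def algebra_simps)
        ultimately show "i \<in> (\<Union>l<d. f l)" by blast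
      qed
      have "(\<Sum>i\<in>J m s. \<theta> ^ n i * \<bar>a i\<bar>) = (\<Sum>l<d. \<Sum>i\<in>f l. \<theta> ^ n i * \<bar>a i\<bar>)"
        unfolding U[symmetric] using finf
      proof (intro sum.UNION_disjoint ballI impI)
        fix l l' :: nat assume "l \<noteq> l'"
        then show "f l \<inter> f l' = {}" using tsep[of l l'] tsep[of l' l] by (metis disjoint_iff less_irrefl nat_neq_iff)
      qed auto
      also have "\<dots> \<le> (\<Sum>l<d. \<theta> ^ Suc m * \<phi> (f l))"
      proof (rule sum_mono)
        fix l assume l: "l \<in> {..<d}"
        then have "\<forall>i\<in>f l. Suc m \<le> n i" using lt U by (metis Suc_leI UN_I)
        then show "(\<Sum>i\<in>f l. \<theta> ^ n i * \<bar>a i\<bar>) \<le> \<theta> ^ Suc m * \<phi> (f l)"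
          unfolding f_def using mK by (intro less.hyps) auto
      qed
      also have "\<dots> = \<theta> ^ m * (\<theta> * (\<Sum>l<d. \<phi> (f l)))" by (simp add: sum_distrib_left mult_ac)
      also have "\<dots> \<le> \<theta> ^ m * \<phi> (\<Union>l<d. f l)"
        using \<theta> fI ord by (intro mult_left_mono super) auto
      finally show ?thesis by (simp only: U)
    qed
  qed
  have J0: "J 0 0 = I'" using t0 t1 by (auto simp: J_def h_def)
  have "(1 / (2 * real d)) powr ?r * pnorm p a I = (\<Sum>i\<in>I'. \<bar>a i\<bar> * (b i / (2 * d)) powr ?r)"
  proof -
    have "(\<Sum>i\<in>I. \<bar>a i\<bar> * b i powr ?r) = (\<Sum>i\<in>I'. \<bar>a i\<bar> * b i powr ?r)"
      using I b(1) by (intro sum.mono_neutral_right) (auto simp: I'_def less_le)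
    then show ?thesis
      by (simp add: ba[symmetric] sum_distrib_left powr_divide mult_ac)
  qed
  also have "\<dots> \<le> (\<Sum>i\<in>I'. \<theta> ^ n i * \<bar>a i\<bar>)"
  proof (rule sum_mono)
    fix i assume i: "i \<in> I'"
    have "real d powr ?r > 0" using d by simp
    \<comment> \<open>The relation between \<theta>, d and p enters here:
      \<open>\<theta> ^ n\<close> is the power 1 - 1/p of the interval length
      \<open>h n\<close>.\<close>
    then have th: "\<theta> = (1 / real d) powr ?r" using \<theta>(3) by (simp add: powr_divide field_simps)
    have "(b i / (2 * d)) powr ?r \<le> h (n i) powr ?r"
      using n(2)[OF i] b(1)[of i] r by (intro powr_mono2) auto
    also have "h (n i) powr ?r = \<theta> ^ n i"
      using d unfolding th h_def by (simp add: powr_powr mult.commute flip: powr_realpow)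
    finally show "\<bar>a i\<bar> * (b i / (2 * d)) powr ?r \<le> \<theta> ^ n i * \<bar>a i\<bar>"
      by (simp add: mult.commute mult_left_mono)
  qed
  also have "\<dots> \<le> \<phi> I'" using main[of 0 0] by (simp add: J0)
  also have "\<dots> \<le> \<phi> I" using I' by (intro mono) auto
  finally show ?thesis .
qed

section \<open>The norm on finitely supported vectors\<close>

lemma proj_c00: "x \<in> c00 k \<Longrightarrow> proj E x \<in> c00 k"
  by (auto simp: c00_def proj_def elim: rev_finite_subset intro: finite_subset)

lemma c00_eq_0: "x \<in> c00 k \<Longrightarrow> v \<notin> nondec_eq k \<Longrightarrow> x v = 0"
  by (auto simp: c00_def)

lemma c00_sum:
  assumes "finite I" "\<And>i. i \<in> I \<Longrightarrow> x i \<in> c00 k"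
  shows "(\<lambda>v. \<Sum>i\<in>I. x i v) \<in> c00 k"
proof -
  have "{v. (\<Sum>i\<in>I. x i v) \<noteq> 0} \<subseteq> (\<Union>i\<in>I. {v. x i v \<noteq> 0})"
    using sum.neutral by force
  then show ?thesis
    using assms by (auto simp: c00_def elim!: finite_subset)
qed

locale T_norm_params =
  fixes k d :: nat and \<theta> :: real
  assumes k: "1 \<le> k" and d: "1 \<le> d" and \<theta>: "0 < \<theta>" "\<theta> < 1"
begin

abbreviation N where "N \<equiv> T_norm_n k d \<theta>"
abbreviation T where "T \<equiv> T_norm k d \<theta>"

lemma N_nonneg: "x \<in> c00 k \<Longrightarrow> 0 \<le> N j x"
  and N_le_sum: "x \<in> c00 k \<Longrightarrow> N j x \<le> (\<Sum>v | x v \<noteq> 0. \<bar>x v\<bar>)"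
  using T_norm_n_bounds[of \<theta> d x k j] d \<theta> by auto

lemma admissible_ex: "\<exists>Es. admissible k d Es"
proof -
  have "r_approx 1 (nondec_eq k) \<in> AR k"
    unfolding AR_def using E_space_nonempty by auto
  then have "admissible k d [r_approx 1 (nondec_eq k)]"
    using d by (auto simp: admissible_def)
  then show ?thesis by blast
qed

text \<open>A bound uniform in the admissible sequence: it makes the supremum in the recursion
  dominate its members.\<close>

lemma admissible_sum_bound:
  assumes "x \<in> c00 k" "admissible k d Es"
  shows "(\<Sum>E\<leftarrow>Es. N j (proj E x)) \<le> (\<Sum>v | x v \<noteq> 0. \<bar>x v\<bar>)"
proof -
  have "N j (proj E x) \<le> (\<Sum>v\<in>{v. x v \<noteq> 0} \<inter> E. \<bar>x v\<bar>)" for E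
  proof -
    have eq: "{v. proj E x v \<noteq> 0} = {v. x v \<noteq> 0} \<inter> E" by (auto simp: proj_def)
    show ?thesis using N_le_sum[OF proj_c00[OF assms(1)], of j E] unfolding eq
      by (simp add: proj_def)
  qed
  then have "(\<Sum>E\<leftarrow>Es. N j (proj E x)) \<le> (\<Sum>E\<leftarrow>Es. \<Sum>v\<in>{v. x v \<noteq> 0} \<inter> E. \<bar>x v\<bar>)"
    by (intro sum_list_mono) auto
  also have "\<dots> \<le> (\<Sum>v | x v \<noteq> 0. \<bar>x v\<bar>)"
    using assms by (intro proj_sum_le) (auto simp: c00_def admissible_def)
  finally show ?thesis .
qed

lemma N_Suc_ge:
  assumes "x \<in> c00 k" "admissible k d Es"
  shows "\<theta> * (\<Sum>E\<leftarrow>Es. N j (proj E x)) \<le> N (Suc j) x"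
proof -
  have "(\<Sum>E\<leftarrow>Es. N j (proj E x)) \<le> (SUP Es\<in>{Es. admissible k d Es}. \<Sum>E\<leftarrow>Es. N j (proj E x))"
    using assms admissible_sum_bound by (intro cSUP_upper bdd_aboveI2) auto
  then show ?thesis using \<theta> by (simp add: mult_left_mono le_max_iff_disj)
qed

lemma N_Suc_le:
  assumes "N j x \<le> B" "\<And>Es. admissible k d Es \<Longrightarrow> \<theta> * (\<Sum>E\<leftarrow>Es. N j (proj E x)) \<le> B"
  shows "N (Suc j) x \<le> B"
proof -
  have "(SUP Es\<in>{Es. admissible k d Es}. \<Sum>E\<leftarrow>Es. N j (proj E x)) \<le> B / \<theta>"
    using assms(2) \<theta> admissible_ex by (intro cSUP_least) (auto simp: field_simps)
  then show ?thesis using assms(1) \<theta> by (simp add: field_simps)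
qed

lemma incseq_N: "incseq (\<lambda>j. N j x)"
  by (rule incseq_SucI) simp

lemma bdd_above_N: "x \<in> c00 k \<Longrightarrow> bdd_above (range (\<lambda>j. N j x))"
  using N_le_sum by (intro bdd_aboveI2) auto

lemma N_le_T: "x \<in> c00 k \<Longrightarrow> N j x \<le> T x"
  unfolding T_norm_def by (intro cSUP_upper bdd_above_N) auto

lemma T_leI: "(\<And>j. N j x \<le> B) \<Longrightarrow> T x \<le> B"
  unfolding T_norm_def by (intro cSUP_least) auto

lemma T_nonneg: "x \<in> c00 k \<Longrightarrow> 0 \<le> T x"
  using N_nonneg N_le_T order_trans by blast

lemma N_tendsto_T: "x \<in> c00 k \<Longrightarrow> (\<lambda>j. N j x) \<longlonglongrightarrow> T x"
  unfolding T_norm_def by (intro LIMSEQ_incseq_SUP incseq_N bdd_above_N)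

lemma abs_le_T:
  assumes "x \<in> c00 k"
  shows "\<bar>x v\<bar> \<le> T x"
proof (cases "v \<in> nondec_eq k")
  case True
  have "\<bar>x v\<bar> \<le> (\<Sum>v | x v \<noteq> 0. \<bar>x v\<bar>)" for v
    using assms member_le_sum[of v "{v. x v \<noteq> 0}" "\<lambda>v. \<bar>x v\<bar>"]
    by (cases "x v = 0") (auto simp: c00_def sum_nonneg)
  then have "\<bar>x v\<bar> \<le> N 0 x" using True by (auto intro!: cSUP_upper bdd_aboveI2)
  then show ?thesis using N_le_T[OF assms, of 0] by linarith
next
  case False
  then show ?thesis using T_nonneg[OF assms] assms by (simp add: c00_eq_0)
qed

lemma N_0_le: "(\<And>v. \<bar>x v\<bar> \<le> B) \<Longrightarrow> N 0 x \<le> B"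
proof -
  have "replicate k 0 \<in> nondec_eq k" by (simp add: nondec_eq_def)
  then show "(\<And>v. \<bar>x v\<bar> \<le> B) \<Longrightarrow> N 0 x \<le> B" by (auto intro!: cSUP_least)
qed

text \<open>The basis is 1-unconditional: projections preserve domination of absolute values, so
  each step of the recursion does.\<close>

lemma N_mono:
  assumes "x \<in> c00 k" "y \<in> c00 k" "\<And>v. \<bar>x v\<bar> \<le> \<bar>y v\<bar>"
  shows "N j x \<le> N j y"
  using assms
proof (induction j arbitrary: x y)
  case 0
  have "\<bar>y v\<bar> \<le> (\<Sum>v | y v \<noteq> 0. \<bar>y v\<bar>)" for v
    using 0 member_le_sum[of v "{v. y v \<noteq> 0}" "\<lambda>v. \<bar>y v\<bar>"]
    by (cases "y v = 0") (auto simp: c00_def sum_nonneg)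
  moreover have "replicate k 0 \<in> nondec_eq k" by (simp add: nondec_eq_def)
  ultimately show ?case using 0 by (auto intro!: cSUP_mono bdd_aboveI2)
next
  case (Suc j)
  show ?case
  proof (rule N_Suc_le)
    show "N j x \<le> N (Suc j) y" using Suc.IH[OF Suc.prems] by simp
    fix Es assume "admissible k d Es"
    have "(\<Sum>E\<leftarrow>Es. N j (proj E x)) \<le> (\<Sum>E\<leftarrow>Es. N j (proj E y))"
      using Suc.prems by (intro sum_list_mono Suc.IH proj_c00) (auto simp: proj_def)
    then have "\<theta> * (\<Sum>E\<leftarrow>Es. N j (proj E x)) \<le> \<theta> * (\<Sum>E\<leftarrow>Es. N j (proj E y))"
      using \<theta> by simp
    also have "\<dots> \<le> N (Suc j) y"
      using Suc.prems \<open>admissible k d Es\<close> by (intro N_Suc_ge)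
    finally show "\<theta> * (\<Sum>E\<leftarrow>Es. N j (proj E x)) \<le> N (Suc j) y" .
  qed
qed

lemma T_mono:
  assumes "x \<in> c00 k" "y \<in> c00 k" "\<And>v. \<bar>x v\<bar> \<le> \<bar>y v\<bar>"
  shows "T x \<le> T y"
  using N_mono[OF assms] N_le_T[OF assms(2)] order_trans by (intro T_leI) blast

lemma T_zero: "T (\<lambda>v. 0) = 0"
proof -
  have z: "(\<lambda>v. 0) \<in> c00 k" by (simp add: c00_def)
  have "N j (\<lambda>v. 0) \<le> 0" for j using N_le_sum[OF z, of j] by simp
  then show ?thesis using T_leI[of "\<lambda>v. 0" 0] T_nonneg[OF z] by (simp add: antisym)
qed

text \<open>The recursion bounds level j by level j + 1; in the limit both levels become the norm
  itself.\<close>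

lemma T_admissible:
  assumes x: "x \<in> c00 k" and E: "admissible k d Es"
  shows "\<theta> * (\<Sum>E\<leftarrow>Es. T (proj E x)) \<le> T x"
proof -
  have "(\<lambda>j. \<Sum>E\<leftarrow>Es. N j (proj E x)) \<longlonglongrightarrow> (\<Sum>E\<leftarrow>Es. T (proj E x))" for Es
    by (induction Es) (auto intro!: tendsto_add N_tendsto_T proj_c00 x)
  then have "(\<lambda>j. \<theta> * (\<Sum>E\<leftarrow>Es. N j (proj E x))) \<longlonglongrightarrow> \<theta> * (\<Sum>E\<leftarrow>Es. T (proj E x))"
    by (intro tendsto_intros)
  moreover have "\<theta> * (\<Sum>E\<leftarrow>Es. N j (proj E x)) \<le> T x" for j
    using N_Suc_ge[OF x E, of j] N_le_T[OF x, of "Suc j"] by linarith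
  ultimately show ?thesis by (intro LIMSEQ_le_const2) auto
qed

end

section \<open>The upper $p$-estimate for block sequences\<close>

lemma prec_asym: "prec a b \<Longrightarrow> \<not> prec b a"
  using lexord_asymmetric[of less_than a b] by (auto simp: prec_def asym_less_than)

lemma prec_trans: "prec a b \<Longrightarrow> prec b c \<Longrightarrow> prec a c"
  using lexord_trans[OF _ _ trans_less_than, of a b c] by (auto simp: prec_def)

lemma set_precD: "set_prec E F \<Longrightarrow> a \<in> E \<Longrightarrow> b \<in> F \<Longrightarrow> prec a b"
  unfolding set_prec_def by (metis prec_trans)

text \<open>A block at an end of the group shares at most one of the cutting sets with other blocks,
  an inner block may share two; hence two constants.\<close>

definition block_const :: "real \<Rightarrow> real \<Rightarrow> nat set \<Rightarrow> nat \<Rightarrow> real" where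
  "block_const \<mu> C I i = (if i = Min I \<or> i = Max I then \<mu> else C)"

text \<open>Combinatorial core of the upper estimate. \<open>F l\<close> stands for the blocks met
  by the l-th set and \<open>w l\<close> for the dual weights of that group. The new weights W have
  to absorb one splitting: all pieces of block i that are alone in their sets are charged together
  as one whole block (the \<open>of_bool\<close> term), and the shared pieces through
  \<open>w\<close>.\<close>

lemma interval_weights:
  fixes F :: "nat \<Rightarrow> nat set" and w :: "nat \<Rightarrow> nat \<Rightarrow> real"
  assumes I: "finite I" and md: "m \<le> d" and d: "1 \<le> d"
    and ord: "\<And>l l' i i'. l < l' \<Longrightarrow> l' < m \<Longrightarrow> i \<in> F l \<Longrightarrow> i' \<in> F l' \<Longrightarrow> i \<le> i'"
    and sub: "\<And>l. l < m \<Longrightarrow> F l \<subseteq> I"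
    and w0: "\<And>l i. 0 \<le> w l i"
    and w1: "\<And>l. l < m \<Longrightarrow> 2 \<le> card (F l) \<Longrightarrow> (\<Sum>i\<in>F l. w l i) \<le> 1"
    and \<theta>: "0 < \<theta>" "\<theta> * real d powr r = 1" and r: "0 < r" and \<mu>: "0 \<le> \<mu>"
    and gap: "\<And>w. 0 \<le> w \<Longrightarrow> w \<le> 1 \<Longrightarrow> 1 + \<theta> * \<mu> * w powr r \<le> \<theta> * \<mu> * (1 + w) powr r"
    and C: "C = 2 * \<mu> + 1 / \<theta>"
  shows "\<exists>W. (\<forall>i. 0 \<le> W i) \<and> (\<Sum>i\<in>I. W i) \<le> (1 :: real) \<and>
    (\<forall>i\<in>I. of_bool (\<exists>l<m. F l = {i})
       + \<theta> * (\<Sum>l | l < m \<and> i \<in> F l \<and> 2 \<le> card (F l). block_const \<mu> C (F l) i * w l i powr r)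
       \<le> block_const \<mu> C I i * W i powr r)"
proof -
  define P where "P i = {l. l < m \<and> F l = {i}}" for i
  define M where "M i = {l. l < m \<and> i \<in> F l \<and> 2 \<le> card (F l)}" for i
  \<comment> \<open>A set meeting block i alone sends it weight 1, a shared set sends its dual
    weight. Each set sends at most 1 in total, and there are at most d sets, so dividing by d yields
    admissible weights.\<close>
  define g where "g l i = (if F l = {i} then 1 else if i \<in> F l \<and> 2 \<le> card (F l) then w l i else 0)" for l i
  define S where "S i = (\<Sum>l<m. g l i)" for i
  define W where "W i = S i / d" for i
  have fin: "finite (P i)" "finite (M i)" for i by (auto simp: P_def M_def)
  have finF: "finite (F l)" if "l < m" for l using sub[OF that] I finite_subset by blast
  have g0: "0 \<le> g l i" for l i using w0 by (auto simp: g_def)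
  have S0: "0 \<le> S i" for i using g0 by (auto simp: S_def intro: sum_nonneg)
  have W0: "0 \<le> W i" for i using S0 by (auto simp: W_def)
  have S_eq: "S i = card (P i) + (\<Sum>l\<in>M i. w l i)" for i
  proof -
    have "g l i = of_bool (l \<in> P i) + (if l \<in> M i then w l i else 0)" if "l < m" for l
      using that by (auto simp: g_def P_def M_def)
    then have "S i = (\<Sum>l<m. of_bool (l \<in> P i)) + (\<Sum>l<m. if l \<in> M i then w l i else 0)"
      by (simp add: S_def sum.distrib)
    also have "(\<Sum>l<m. of_bool (l \<in> P i)) = real (card (P i))"
      by (simp add: sum.If_cases of_bool_def) (auto intro!: arg_cong[where f = card] simp: P_def)
    also have "(\<Sum>l<m. if l \<in> M i then w l i else 0) = (\<Sum>l\<in>M i. w l i)"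
      by (subst sum.If_cases) (auto intro!: sum.cong simp: M_def)
    finally show ?thesis .
  qed
  have "(\<Sum>i\<in>I. S i) = (\<Sum>l<m. \<Sum>i\<in>I. g l i)"
    unfolding S_def by (rule sum.swap)
  also have "\<dots> \<le> (\<Sum>l<m. 1)"
  proof (rule sum_mono)
    fix l assume l: "l \<in> {..<m}"
    have "(\<Sum>i\<in>I. g l i) = (\<Sum>i\<in>F l. g l i)"
      using I sub[of l] l by (intro sum.mono_neutral_right) (auto simp: g_def)
    also have "\<dots> \<le> 1"
    proof (cases "2 \<le> card (F l)")
      case True
      then have "(\<Sum>i\<in>F l. g l i) = (\<Sum>i\<in>F l. w l i)"
        by (intro sum.cong) (auto simp: g_def)
      then show ?thesis using w1[of l] l True by simp
    next
      case False
      then have "card (F l) = 0 \<or> card (F l) = 1" by linarith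
      then show ?thesis using finF[of l] l by (auto simp: card_1_singleton_iff g_def)
    qed
    finally show "(\<Sum>i\<in>I. g l i) \<le> 1" .
  qed
  also have "\<dots> \<le> d" using md by simp
  finally have W1: "(\<Sum>i\<in>I. W i) \<le> 1"
    using d by (simp add: W_def field_simps flip: sum_divide_distrib)
  have Wr: "W i powr r = \<theta> * S i powr r" for i
  proof -
    have "real d powr r > 0" using d by simp
    then have "\<theta> = 1 / real d powr r" using \<theta>(2) by (simp add: field_simps)
    then show ?thesis by (simp add: W_def powr_divide)
  qed
  have "of_bool (P i \<noteq> {}) + \<theta> * (\<Sum>l\<in>M i. block_const \<mu> C (F l) i * w l i powr r)
       \<le> block_const \<mu> C I i * (\<theta> * S i powr r)" if i: "i \<in> I" for i
  \<comment> \<open>If i lies strictly inside some group, no other set meets block i. Both constants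
    are then C, and the claim is an equality.\<close>
  proof (cases "\<exists>l\<in>M i. i \<noteq> Min (F l) \<and> i \<noteq> Max (F l)")
    case True
    then obtain l where l: "l \<in> M i" "i \<noteq> Min (F l)" "i \<noteq> Max (F l)" by blast
    then have lm: "l < m" and il: "i \<in> F l" by (auto simp: M_def)
    have "F l \<noteq> {}" using il by auto
    then have mi: "Min (F l) \<in> F l" "Min (F l) < i" "Max (F l) \<in> F l" "i < Max (F l)"
      using l(2,3) finF[OF lm] il Min_le[of "F l" i] Max_ge[of "F l" i] Min_in[of "F l"] Max_in[of "F l"]
      by (simp_all add: le_less)
    have only: "l' = l" if "l' < m" "i \<in> F l'" for l'
      using ord[of l l' "Max (F l)" i] ord[of l' l i "Min (F l)"] that lm mi
      by (metis linorder_neqE_nat not_le)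
    have "F l \<noteq> {i}" using mi by auto
    then have "P i = {}" using only unfolding P_def by blast
    have Ml: "M i = {l}" using only l unfolding M_def by blast
    have "i \<noteq> Min I" "i \<noteq> Max I"
      using Min_le[OF I, of "Min (F l)"] Max_ge[OF I, of "Max (F l)"] subsetD[OF sub[OF lm]] mi by fastforce+
    then have "block_const \<mu> C I i = C" "block_const \<mu> C (F l) i = C"
      using l by (auto simp: block_const_def)
    then show ?thesis using \<open>P i = {}\<close> Ml by (simp add: S_eq)
  next
    case False
    then have M\<mu>: "(\<Sum>l\<in>M i. block_const \<mu> C (F l) i * w l i powr r) = \<mu> * (\<Sum>l\<in>M i. w l i powr r)"
      by (auto simp: block_const_def sum_distrib_left intro!: sum.cong)
    have other: "\<exists>i'\<in>F l. i' \<noteq> i" if "l \<in> M i" for l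
    proof (rule ccontr)
      assume "\<not> (\<exists>i'\<in>F l. i' \<noteq> i)"
      then have "F l \<subseteq> {i}" by auto
      then have "card (F l) \<le> 1" using card_mono[of "{i}" "F l"] by simp
      then show False using that by (simp add: M_def)
    qed
    have wle: "w l i \<le> 1" if "l \<in> M i" for l
    proof -
      have "w l i \<le> (\<Sum>i\<in>F l. w l i)"
        using that finF w0 by (intro member_le_sum) (auto simp: M_def)
      then show ?thesis using w1[of l] that by (auto simp: M_def)
    qed
    show ?thesis
    proof (cases "i = Min I \<or> i = Max I")
      case True
      \<comment> \<open>Two shared sets would give other blocks on both sides of i, which is
        impossible at an end of I.\<close>
      have "l = l'" if "l \<in> M i" "l' \<in> M i" for l l'
      proof -
        have no: False if lM: "l \<in> M i" "l' \<in> M i" and "l < l'" for l l'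
        proof -
          obtain a b where ab: "a \<in> F l" "a \<noteq> i" "b \<in> F l'" "b \<noteq> i" using other lM by blast
          have "l < m" "l' < m" "i \<in> F l" "i \<in> F l'" using lM by (auto simp: M_def)
          then have "a \<le> i" "i \<le> b" "a \<in> I" "b \<in> I" using ord[OF \<open>l < l'\<close>] ab sub by blast+
          then show False using True ab Min_le[OF I, of a] Max_ge[OF I, of b] by auto
        qed
        show ?thesis using no[of l l'] no[of l' l] that by (meson linorder_neqE_nat)
      qed
      then obtain l where "M i = {} \<or> M i = {l}" by blast
      then obtain u where u: "0 \<le> u" "u \<le> 1" "(\<Sum>l\<in>M i. w l i) = u" "(\<Sum>l\<in>M i. w l i powr r) = u powr r"
        using wle[of l] w0[of l i] r by (cases "M i = {}") force+
      \<comment> \<open>\<open>u\<close> is the weight from the only shared set, or 0. The gap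
        inequality makes room for the pieces that are alone.\<close>
      have "of_bool (P i \<noteq> {}) + \<theta> * \<mu> * u powr r \<le> \<theta> * \<mu> * S i powr r"
      proof (cases "P i = {}")
        case False
        then have "card (P i) \<ge> 1" using fin by (simp add: Suc_le_eq card_gt_0_iff)
        then have "(1 + u) powr r \<le> S i powr r" using u r by (intro powr_mono2) (auto simp: S_eq)
        then have "\<theta> * \<mu> * (1 + u) powr r \<le> \<theta> * \<mu> * S i powr r"
          using \<theta> \<mu> by (intro mult_left_mono) auto
        then show ?thesis using gap[OF u(1,2)] False by simp
      qed (simp add: S_eq u)
      moreover have "block_const \<mu> C I i = \<mu>" using True by (auto simp: block_const_def)
      ultimately show ?thesis unfolding M\<mu> u(4) by (simp only: mult_ac)
    next
      case False
      \<comment> \<open>A set strictly between the first and the last set in \<open>M i\<close>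
        could meet no block but i, so it would not be shared.\<close>
      have "card (M i) \<le> 2"
      proof (cases "M i = {}")
        case ne: False
        have "l = Min (M i) \<or> l = Max (M i)" if l: "l \<in> M i" for l
        proof (rule ccontr)
          assume "\<not> ?thesis"
          then have lt: "Min (M i) < l" "l < Max (M i)" using fin l by (auto simp: less_le)
          obtain a where a: "a \<in> F l" "a \<noteq> i" using other l by blast
          have "Min (M i) \<in> M i" "Max (M i) \<in> M i" using fin ne by auto
          then have "i \<in> F (Min (M i))" "i \<in> F (Max (M i))" "Max (M i) < m" "l < m"
            using l by (auto simp: M_def)
          then have "i \<le> a" "a \<le> i" using ord[OF lt(1)] ord[OF lt(2)] a by auto
          then show False using a by simp
        qed
        then have "M i \<subseteq> {Min (M i), Max (M i)}" by blast
        then have "card (M i) \<le> card {Min (M i), Max (M i)}" by (intro card_mono) auto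
        also have "\<dots> \<le> 2" by (simp add: card_insert_if)
        finally show ?thesis .
      qed simp
      have "(\<Sum>l\<in>M i. w l i powr r) \<le> (\<Sum>l\<in>M i. S i powr r)"
      proof (rule sum_mono)
        fix l assume "l \<in> M i"
        then have "w l i \<le> (\<Sum>l\<in>M i. w l i)" using fin w0 by (intro member_le_sum) auto
        then have "w l i \<le> S i" by (simp add: S_eq)
        then show "w l i powr r \<le> S i powr r" using w0 r by (intro powr_mono2) auto
      qed
      also have "\<dots> \<le> 2 * S i powr r" using \<open>card (M i) \<le> 2\<close> by (simp add: mult_right_mono)
      finally have A: "\<theta> * \<mu> * (\<Sum>l\<in>M i. w l i powr r) \<le> \<theta> * \<mu> * (2 * S i powr r)"
        using \<theta> \<mu> by (intro mult_left_mono) auto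
      have B: "of_bool (P i \<noteq> {}) \<le> S i powr r"
      proof (cases "P i = {}")
        case False
        then have "card (P i) \<ge> 1" using fin by (simp add: Suc_le_eq card_gt_0_iff)
        moreover have "0 \<le> (\<Sum>l\<in>M i. w l i)" using w0 by (simp add: sum_nonneg)
        ultimately have "1 \<le> S i" by (simp add: S_eq)
        then show ?thesis using r ge_one_powr_ge_zero[of "S i" r] by simp
      qed simp
      \<comment> \<open>The choice of C: 2 \<mu> pays for the two shared pieces and 1 / \<theta> for
        the pieces that are alone.\<close>
      have "C * \<theta> = 2 * \<theta> * \<mu> + 1" using \<theta> by (simp add: C field_simps)
      then have "C * (\<theta> * S i powr r) = \<theta> * \<mu> * (2 * S i powr r) + S i powr r"
        by (metis (no_types, opaque_lifting) distrib_right mult.assoc mult.commute mult_1)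
      then show ?thesis using A B False M\<mu> by (simp add: block_const_def algebra_simps)
    qed
  qed
  moreover have "(\<exists>l<m. F l = {i}) \<longleftrightarrow> P i \<noteq> {}" for i by (auto simp: P_def)
  ultimately show ?thesis
    using W0 W1 Wr by (intro exI[of _ W]) (auto simp: M_def)
qed

lemma proj_sum_blocks:
  assumes "finite I"
  shows "proj E (\<lambda>v. \<Sum>i\<in>I. x i v) = (\<lambda>v. \<Sum>i\<in>{i \<in> I. \<exists>v\<in>E. x i v \<noteq> 0}. proj E (x i) v)"
proof
  fix v
  have "(\<Sum>i\<in>I. proj E (x i) v) = (\<Sum>i\<in>{i \<in> I. \<exists>v\<in>E. x i v \<noteq> 0}. proj E (x i) v)"
    using assms by (intro sum.mono_neutral_right) (auto simp: proj_def)
  then show "proj E (\<lambda>v. \<Sum>i\<in>I. x i v) v = (\<Sum>i\<in>{i \<in> I. \<exists>v\<in>E. x i v \<noteq> 0}. proj E (x i) v)"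
    by (auto simp: proj_def)
qed

context T_norm_params
begin

text \<open>A block which is cut by the sets of an admissible sequence has at most two pieces sharing
  their set with other blocks. Such a piece is the first or the last block of its set, where the
  smaller constant \<open>\<mu>\<close> is available; all other pieces together have norm at most that of the
  block. This is why the constants do not grow with the depth \<open>j\<close>.\<close>

lemma N_block_upper:
  assumes p: "1 < p" and \<theta>d: "\<theta> * real d powr (1 - 1 / p) = 1" and \<mu>: "1 \<le> \<mu>"
    and gap: "\<And>w. 0 \<le> w \<Longrightarrow> w \<le> 1 \<Longrightarrow>
      1 + \<theta> * \<mu> * w powr (1 - 1 / p) \<le> \<theta> * \<mu> * (1 + w) powr (1 - 1 / p)"
    and C: "C = 2 * \<mu> + 1 / \<theta>"
    and "finite I" "2 \<le> card I" "\<And>i. i \<in> I \<Longrightarrow> x i \<in> c00 k" "\<And>i. i \<in> I \<Longrightarrow> T (x i) \<le> b i"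
    and "\<And>i i' v v'. i \<in> I \<Longrightarrow> i' \<in> I \<Longrightarrow> i < i' \<Longrightarrow> x i v \<noteq> 0 \<Longrightarrow> x i' v' \<noteq> 0 \<Longrightarrow> prec v v'"
  shows "N j (\<lambda>v. \<Sum>i\<in>I. x i v) \<le> pnorm p (\<lambda>i. block_const \<mu> C I i * b i) I"
  using assms(6-)
proof (induction j arbitrary: I x)
  case (0 I x)
  have "1 \<le> C" using \<mu> divide_pos_pos[OF zero_less_one \<theta>(1)] C by linarith
  then have bc: "1 \<le> block_const \<mu> C I i" for i using \<mu> by (simp add: block_const_def)
  show ?case
  proof (rule N_0_le)
    fix v
    show "\<bar>\<Sum>i\<in>I. x i v\<bar> \<le> pnorm p (\<lambda>i. block_const \<mu> C I i * b i) I"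
    proof (cases "\<exists>i\<in>I. x i v \<noteq> 0")
      case True
      then obtain i where i: "i \<in> I" "x i v \<noteq> 0" by blast
      have "x i' v = 0" if "i' \<in> I" "i' \<noteq> i" for i'
        using 0(5)[of i i' v v] 0(5)[of i' i v v] prec_asym[of v v] i that
        by (metis linorder_neqE_nat)
      then have "(\<Sum>i\<in>I. x i v) = (\<Sum>i'\<in>I. if i' = i then x i v else 0)"
        by (intro sum.cong) auto
      then have "\<bar>\<Sum>i\<in>I. x i v\<bar> = \<bar>x i v\<bar>" using i 0(1) by simp
      also have "\<dots> \<le> b i" using abs_le_T[OF 0(3)[OF i(1)]] 0(4)[OF i(1)] order_trans by blast
      also have "\<dots> \<le> \<bar>block_const \<mu> C I i * b i\<bar>"
        using mult_right_mono[OF bc[of i], of "\<bar>b i\<bar>"] bc[of i] by (simp add: abs_mult)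
      also have "\<dots> \<le> pnorm p (\<lambda>i. block_const \<mu> C I i * b i) I"
        using p 0(1) i by (intro abs_le_pnorm) auto
      finally show ?thesis .
    qed simp
  qed
next
  case (Suc j I x)
  let ?r = "1 - 1 / p"
  define X where "X = (\<lambda>v. \<Sum>i\<in>I. x i v)"
  have b0: "0 \<le> b i" if "i \<in> I" for i
    using T_nonneg[OF Suc.prems(3)[OF that]] Suc.prems(4)[OF that] by linarith
  have "1 \<le> C" using \<mu> divide_pos_pos[OF zero_less_one \<theta>(1)] C by linarith
  then have bc: "0 \<le> block_const \<mu> C J i" for J i using \<mu> by (simp add: block_const_def)
  show ?case
  proof (rule N_Suc_le)
    show "N j (\<lambda>v. \<Sum>i\<in>I. x i v) \<le> pnorm p (\<lambda>i. block_const \<mu> C I i * b i) I"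
      by (rule Suc.IH[OF Suc.prems])
    fix Es assume Es: "admissible k d Es"
    define m where "m = length Es"
    have md: "m \<le> d" using Es by (simp add: admissible_def m_def)
    define F where "F l = {i \<in> I. \<exists>v\<in>Es ! l. x i v \<noteq> 0}" for l
    define y where "y l i = proj (Es ! l) (x i)" for l i
    have FI: "F l \<subseteq> I" for l by (auto simp: F_def)
    have finF: "finite (F l)" for l using FI Suc.prems(1) finite_subset by blast
    have y: "y l i \<in> c00 k" if "i \<in> I" for l i
      using that Suc.prems by (simp add: y_def proj_c00)
    have proj_X: "proj (Es ! l) X = (\<lambda>v. \<Sum>i\<in>F l. y l i v)" for l
      unfolding X_def y_def F_def by (rule proj_sum_blocks) (rule Suc.prems)
    have big: "N j (proj (Es ! l) X) \<le> pnorm p (\<lambda>i. block_const \<mu> C (F l) i * b i) (F l)"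
      if "2 \<le> card (F l)" for l
      unfolding proj_X
    proof (rule Suc.IH[OF finF that])
      fix i assume "i \<in> F l"
      then have i: "i \<in> I" using FI by blast
      then show "y l i \<in> c00 k" by (rule y)
      have "T (y l i) \<le> T (x i)"
        using i y Suc.prems by (intro T_mono) (auto simp: y_def proj_def)
      then show "T (y l i) \<le> b i" using Suc.prems(4)[OF i] by linarith
    next
      fix i i' v v' assume "i \<in> F l" "i' \<in> F l" "i < i'" "y l i v \<noteq> 0" "y l i' v' \<noteq> 0"
      then show "prec v v'" using FI[of l] Suc.prems(5)[of i i' v v']
        by (auto simp: y_def proj_def split: if_splits)
    qed
    have "\<exists>w. (\<forall>i. 0 \<le> w i) \<and> (\<Sum>i\<in>F l. w i) \<le> 1 \<and>
      (\<Sum>i\<in>F l. block_const \<mu> C (F l) i * b i * w i powr ?r) =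
         pnorm p (\<lambda>i. block_const \<mu> C (F l) i * b i) (F l)" for l
    proof -
      have "0 \<le> block_const \<mu> C (F l) i * b i" if "i \<in> F l" for i
        using b0 bc subsetD[OF FI that] by simp
      then show ?thesis by (rule pnorm_dual_weights[OF p]) blast+
    qed
    from choice[OF allI[OF this]] obtain w where
      w': "\<forall>l. (\<forall>i. 0 \<le> w l i) \<and> (\<Sum>i\<in>F l. w l i) \<le> 1 \<and>
        (\<Sum>i\<in>F l. block_const \<mu> C (F l) i * b i * w l i powr ?r) =
          pnorm p (\<lambda>i. block_const \<mu> C (F l) i * b i) (F l)" ..
    have w: "0 \<le> w l i" "(\<Sum>i\<in>F l. w l i) \<le> 1"
      "(\<Sum>i\<in>F l. block_const \<mu> C (F l) i * b i * w l i powr ?r) =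
         pnorm p (\<lambda>i. block_const \<mu> C (F l) i * b i) (F l)" for l i
      using w'[rule_format, of l] by simp_all
    \<comment> \<open>Only \<le>, since consecutive sets may cut the same block.\<close>
    have ord: "i \<le> i'" if "l < l'" "l' < m" "i \<in> F l" "i' \<in> F l'" for l l' i i'
    proof (rule ccontr)
      assume "\<not> i \<le> i'"
      obtain v v' where v: "v \<in> Es ! l" "x i v \<noteq> 0" "v' \<in> Es ! l'" "x i' v' \<noteq> 0"
        using \<open>i \<in> F l\<close> \<open>i' \<in> F l'\<close> by (auto simp: F_def)
      have "set_prec (Es ! l) (Es ! l')"
        using Es that by (auto simp: admissible_def m_def intro: sorted_wrt_nth_less)
      then have "prec v v'" using v set_precD by blast
      moreover have "prec v' v"
        using Suc.prems(5)[of i' i v' v] v that FI[of l] FI[of l'] \<open>\<not> i \<le> i'\<close> by auto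
      ultimately show False using prec_asym by blast
    qed
    have r: "0 < ?r" and \<mu>0: "0 \<le> \<mu>" using p \<mu> by auto
    have "\<exists>W. (\<forall>i. 0 \<le> W i) \<and> (\<Sum>i\<in>I. W i) \<le> (1 :: real) \<and>
      (\<forall>i\<in>I. of_bool (\<exists>l<m. F l = {i})
         + \<theta> * (\<Sum>l | l < m \<and> i \<in> F l \<and> 2 \<le> card (F l). block_const \<mu> C (F l) i * w l i powr ?r)
         \<le> block_const \<mu> C I i * W i powr ?r)"
      by (rule interval_weights[where F = F and w = w and d = d])
        (assumption | rule Suc.prems(1) md d ord FI w \<theta>(1) \<theta>d r \<mu>0 gap C)+
    then obtain W where W: "\<forall>i. 0 \<le> W i" "(\<Sum>i\<in>I. W i) \<le> (1 :: real)"
      "\<forall>i\<in>I. of_bool (\<exists>l<m. F l = {i})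
         + \<theta> * (\<Sum>l | l < m \<and> i \<in> F l \<and> 2 \<le> card (F l). block_const \<mu> C (F l) i * w l i powr ?r)
         \<le> block_const \<mu> C I i * W i powr ?r" by (elim exE conjE)
    define P where "P i = (\<Sum>l<m. if F l = {i} then N j (y l i) else 0)" for i
    define Q where "Q i = (\<Sum>l<m. if i \<in> F l \<and> 2 \<le> card (F l)
      then block_const \<mu> C (F l) i * b i * w l i powr ?r else 0)" for i
    have "N j (proj (Es ! l) X) \<le> (\<Sum>i\<in>I. (if F l = {i} then N j (y l i) else 0) +
       (if i \<in> F l \<and> 2 \<le> card (F l) then block_const \<mu> C (F l) i * b i * w l i powr ?r else 0))"
      (is "_ \<le> ?S l") for l
    proof -
      \<comment> \<open>The induction hypothesis is used only for groups of two or more blocks. A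
        set meeting one block keeps the exact norm of its piece, because these pieces have to be
        added up without loss.\<close>
      consider "card (F l) = 0" | "card (F l) = 1" | "2 \<le> card (F l)" by linarith
      then show ?thesis
      proof cases
        case 1
        then have "proj (Es ! l) X = (\<lambda>v. 0)" using finF by (simp add: proj_X)
        moreover have "(\<lambda>v. 0) \<in> c00 k" by (simp add: c00_def)
        then have "N j (\<lambda>v. 0) \<le> 0" using N_le_T[of "\<lambda>v. 0" j] by (simp add: T_zero)
        moreover have "?S l = 0" using 1 finF by (simp add: card_eq_0_iff)
        ultimately show ?thesis by simp
      next
        case 2
        then obtain i where i: "F l = {i}" by (auto simp: card_1_singleton_iff)
        then have "i \<in> I" using FI[of l] by simp
        then have "?S l = N j (y l i)" using Suc.prems(1) by (simp add: i)
        then show ?thesis by (simp add: proj_X i)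
      next
        case 3
        then have "F l \<noteq> {i}" for i by auto
        moreover have "(\<Sum>i\<in>I. if i \<in> F l then block_const \<mu> C (F l) i * b i * w l i powr ?r else 0)
           = (\<Sum>i\<in>F l. block_const \<mu> C (F l) i * b i * w l i powr ?r)"
          using FI[of l] Suc.prems(1) by (simp add: sum.If_cases Int_absorb1)
        ultimately show ?thesis using big[OF 3] w(3)[of l] 3 by simp
      qed
    qed
    then have "(\<Sum>l<m. N j (proj (Es ! l) X)) \<le> (\<Sum>l<m. ?S l)" by (intro sum_mono)
    also have "\<dots> = (\<Sum>i\<in>I. P i + Q i)"
      unfolding P_def Q_def by (subst sum.swap) (simp add: sum.distrib)
    finally have "\<theta> * (\<Sum>l<m. N j (proj (Es ! l) X)) \<le> \<theta> * (\<Sum>i\<in>I. P i + Q i)"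
      using \<theta> by simp
    also have "\<dots> = (\<Sum>i\<in>I. \<theta> * P i + \<theta> * Q i)"
      by (simp add: sum_distrib_left distrib_left)
    also have "\<dots> \<le> (\<Sum>i\<in>I. block_const \<mu> C I i * b i * W i powr ?r)"
    proof (rule sum_mono)
      fix i assume i: "i \<in> I"
      \<comment> \<open>The pieces of \<open>x i\<close> that are alone in their sets are some of
        the terms of an admissible sum for \<open>x i\<close> itself, so together they cost at most
        its norm.\<close>
      have P: "\<theta> * P i \<le> b i * of_bool (\<exists>l<m. F l = {i})"
      proof (cases "\<exists>l<m. F l = {i}")
        case True
        have "P i \<le> (\<Sum>l<m. N j (y l i))"
          unfolding P_def using N_nonneg[OF y[OF i]] by (intro sum_mono) auto
        also have "\<dots> = (\<Sum>E\<leftarrow>Es. N j (proj E (x i)))"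
          by (simp add: sum_list_sum_nth y_def m_def atLeast0LessThan)
        finally have "\<theta> * P i \<le> \<theta> * (\<Sum>E\<leftarrow>Es. N j (proj E (x i)))" using \<theta> by simp
        also have "\<dots> \<le> N (Suc j) (x i)" using Suc.prems(3)[OF i] Es by (rule N_Suc_ge)
        also have "\<dots> \<le> T (x i)" using Suc.prems(3)[OF i] by (rule N_le_T)
        also have "\<dots> \<le> b i" by (rule Suc.prems(4)[OF i])
        finally show ?thesis using True by simp
      qed (auto simp: P_def intro!: sum.neutral)
      have "Q i = (\<Sum>l | l < m \<and> i \<in> F l \<and> 2 \<le> card (F l). block_const \<mu> C (F l) i * b i * w l i powr ?r)"
        unfolding Q_def by (subst sum.If_cases) (auto intro!: sum.cong)
      then have Q: "Q i = b i * (\<Sum>l | l < m \<and> i \<in> F l \<and> 2 \<le> card (F l). block_const \<mu> C (F l) i * w l i powr ?r)"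
        by (simp add: sum_distrib_left mult_ac)
      show "\<theta> * P i + \<theta> * Q i \<le> block_const \<mu> C I i * b i * W i powr ?r"
        using P mult_left_mono[OF W(3)[rule_format, OF i] b0[OF i]] by (simp add: Q algebra_simps)
    qed
    \<comment> \<open>Hoelder's inequality for the new weights closes the induction with the same
      constants.\<close>
    also have "\<dots> \<le> pnorm p (\<lambda>i. block_const \<mu> C I i * b i) I"
      using sum_mult_powr_le_pnorm[OF p Suc.prems(1) W(1)[rule_format] W(2)] .
    finally show "\<theta> * (\<Sum>E\<leftarrow>Es. N j (proj E (\<lambda>v. \<Sum>i\<in>I. x i v))) \<le> pnorm p (\<lambda>i. block_const \<mu> C I i * b i) I"
      by (simp add: sum_list_sum_nth X_def m_def atLeast0LessThan)
  qed
qed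

lemma T_block_upper:
  assumes p: "1 < p" and \<theta>d: "\<theta> * real d powr (1 - 1 / p) = 1"
  obtains C where "0 < C" "\<And>I x b. finite I \<Longrightarrow> (\<And>i. i \<in> I \<Longrightarrow> x i \<in> c00 k) \<Longrightarrow>
      (\<And>i. i \<in> I \<Longrightarrow> T (x i) \<le> b i) \<Longrightarrow>
      (\<And>i i' v v'. i \<in> I \<Longrightarrow> i' \<in> I \<Longrightarrow> i < i' \<Longrightarrow> x i v \<noteq> 0 \<Longrightarrow> x i' v' \<noteq> 0 \<Longrightarrow> prec v v') \<Longrightarrow>
      T (\<lambda>v. \<Sum>i\<in>(I :: nat set). x i v) \<le> C * pnorm p b I"
proof -
  let ?r = "1 - 1 / p"
  obtain \<kappa> where \<kappa>: "0 < \<kappa>" "\<And>w. 0 \<le> w \<Longrightarrow> w \<le> 1 \<Longrightarrow> w powr ?r + \<kappa> \<le> (1 + w) powr ?r"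
    using powr_gap[of ?r] p by auto
  \<comment> \<open>Large enough for \<theta> \<mu> \<kappa> \<ge> 1, which enlarges the gap
    \<kappa> to the required margin 1.\<close>
  define \<mu> where "\<mu> = max 1 (1 / (\<theta> * \<kappa>))"
  define C where "C = 2 * \<mu> + 1 / \<theta>"
  have \<mu>: "1 \<le> \<mu>" by (simp add: \<mu>_def)
  have C: "\<mu> \<le> C" "1 \<le> C" using \<mu> divide_pos_pos[OF zero_less_one \<theta>(1)] unfolding C_def by linarith+
  have "1 \<le> \<theta> * \<mu> * \<kappa>"
  proof -
    have "1 = \<theta> * (1 / (\<theta> * \<kappa>)) * \<kappa>" using \<theta> \<kappa> by simp
    also have "\<dots> \<le> \<theta> * \<mu> * \<kappa>"
      using \<theta> \<kappa> by (intro mult_right_mono mult_left_mono) (auto simp: \<mu>_def)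
    finally show ?thesis .
  qed
  then have gap: "1 + \<theta> * \<mu> * w powr ?r \<le> \<theta> * \<mu> * (1 + w) powr ?r" if "0 \<le> w" "w \<le> 1" for w
    using mult_left_mono[OF \<kappa>(2)[OF that], of "\<theta> * \<mu>"] \<theta> \<mu> by (simp add: distrib_left)
  show ?thesis
  proof (rule that[of C])
    fix I :: "nat set" and x b
    assume I: "finite I" and x: "\<And>i. i \<in> I \<Longrightarrow> x i \<in> c00 k" and b: "\<And>i. i \<in> I \<Longrightarrow> T (x i) \<le> b i"
      and blocks: "\<And>i i' v v'. i \<in> I \<Longrightarrow> i' \<in> I \<Longrightarrow> i < i' \<Longrightarrow> x i v \<noteq> 0 \<Longrightarrow> x i' v' \<noteq> 0 \<Longrightarrow> prec v v'"
    consider "card I = 0" | "card I = 1" | "2 \<le> card I" by linarith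
    then show "T (\<lambda>v. \<Sum>i\<in>I. x i v) \<le> C * pnorm p b I"
    proof cases
      case 1
      then show ?thesis using I by (simp add: T_zero pnorm_def)
    next
      case 2
      then obtain i where i: "I = {i}" by (auto simp: card_1_singleton_iff)
      have "T (x i) \<le> \<bar>b i\<bar>" using b[of i] i by simp
      also have "\<dots> \<le> pnorm p b I" using p i by (intro abs_le_pnorm) auto
      also have "\<dots> \<le> C * pnorm p b I" using C mult_right_mono[of 1 C "pnorm p b I"] by simp
      finally show ?thesis by (simp add: i)
    next
      case 3
      have "T (\<lambda>v. \<Sum>i\<in>I. x i v) \<le> pnorm p (\<lambda>i. block_const \<mu> C I i * b i) I"
        by (intro T_leI N_block_upper[OF p \<theta>d \<mu> gap C_def I 3 x b blocks]) 
      also have "\<dots> \<le> pnorm p (\<lambda>i. C * b i) I"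
        using p \<mu> C by (intro pnorm_mono) (auto simp: block_const_def abs_mult intro!: mult_right_mono)
      also have "\<dots> = C * pnorm p b I" using C p by (simp add: pnorm_cmult)
      finally show ?thesis .
    qed
  qed (use C in simp)
qed

end

section \<open>Members of $\mathcal{AR}^k$ covering blocks\<close>

text \<open>The zeros at the first \<open>length s\<close> positions are sent to \<open>s\<close>: the image of \<open>shift s N\<close>
  contains every \<open>s @ u\<close> with entries of \<open>u\<close> at least \<open>N\<close>, and the constant sequence \<open>0\<close> is
  mapped to the least of these.\<close>

definition shift :: "nat list \<Rightarrow> nat \<Rightarrow> nat list \<Rightarrow> nat list" where
  "shift s N u = map (\<lambda>j. if j < length s \<and> u ! j = 0 then s ! j else u ! j + N) [0..<length u]"

lemma length_shift [simp]: "length (shift s N u) = length u"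
  by (simp add: shift_def)

lemma nth_shift: "j < length u \<Longrightarrow> shift s N u ! j = (if j < length s \<and> u ! j = 0 then s ! j else u ! j + N)"
  by (simp add: shift_def)

lemma take_shift: "take n (shift s N u) = shift s N (take n u)"
  by (rule nth_equalityI) (auto simp: nth_shift)

lemma shift_eq_Nil [simp]: "shift s N u = [] \<longleftrightarrow> u = []"
  by (simp add: shift_def)

lemma sorted_nth_le_last: "sorted xs \<Longrightarrow> j < length xs \<Longrightarrow> xs ! j \<le> last xs"
  by (cases "xs = []") (auto simp: last_conv_nth sorted_iff_nth_mono)

lemma sorted_shift:
  assumes "sorted s" "\<forall>x\<in>set s. x \<le> N" "sorted u"
  shows "sorted (shift s N u)"
  unfolding sorted_iff_nth_mono
proof (intro allI impI)
  fix i j assume ij: "i \<le> j" "j < length (shift s N u)"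
  then have "u ! i \<le> u ! j" using assms(3) by (auto simp: sorted_iff_nth_mono)
  moreover have "i < length s \<Longrightarrow> s ! i \<le> N" using assms(2) by auto
  moreover have "j < length s \<Longrightarrow> s ! i \<le> s ! j"
    using assms(1) ij by (auto simp: sorted_iff_nth_mono)
  ultimately show "shift s N u ! i \<le> shift s N u ! j"
    using ij by (auto simp: nth_shift)
qed

lemma last_shift_le:
  assumes "\<forall>x\<in>set s. x \<le> N" "u \<noteq> []"
  shows "last (shift s N u) \<le> last u + N"
proof -
  have "j < length s \<Longrightarrow> s ! j \<le> N" for j using assms(1) by auto
  then show ?thesis using assms(2) by (auto simp: last_conv_nth nth_shift trans_le_add2)
qed

lemma last_shift: "u \<noteq> [] \<Longrightarrow> 0 < last u \<or> length s < length u \<Longrightarrow> last (shift s N u) = last u + N"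
  by (auto simp: last_conv_nth nth_shift)

lemma strict_prefix_iff_take: "strict_prefix u w \<longleftrightarrow> length u < length w \<and> take (length u) w = u"
  by (auto simp: strict_prefix_def prefix_def) (metis append_take_drop_id)

lemma strict_prefix_shift: "strict_prefix u w \<Longrightarrow> strict_prefix (shift s N u) (shift s N w)"
  by (auto simp: strict_prefix_iff_take take_shift)

text \<open>Only zeros at the first \<open>length s\<close> positions are treated specially: a
  positive last entry moves by exactly N, and a last entry 0 goes to at most N.\<close>

lemma prec_shift:
  assumes s: "sorted s" "\<forall>x\<in>set s. x \<le> N" and u: "sorted u" and w: "sorted w" and "prec u w"
  shows "prec (shift s N u) (shift s N w)"
proof (cases "u = []")
  case True
  then show ?thesis using \<open>prec u w\<close> by (auto simp: prec_def)
next
  case False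
  then have ne: "u \<noteq> []" "w \<noteq> []" using \<open>prec u w\<close> by (auto simp: prec_def)
  from \<open>prec u w\<close> ne have "last u < last w \<or> last u = last w \<and> (u, w) \<in> lexord less_than"
    by (auto simp: prec_def)
  then consider "last u < last w" | "last u = last w" "strict_prefix u w"
    | i where "last u = last w" "i < length u" "i < length w" "take i u = take i w" "u ! i < w ! i"
    unfolding lexord_take_index_conv strict_prefix_iff_take by force
  then show ?thesis
  proof cases
    case 1
    then have "last (shift s N u) < last (shift s N w)"
      using last_shift_le[OF s(2) ne(1)] last_shift[OF ne(2), of s N] by simp
    then show ?thesis using ne by (simp add: prec_def)
  next
    case 2
    \<comment> \<open>The last entry of \<open>u\<close> may be a replaced zero, so equal last
      entries can become different; sortedness of the image of \<open>w\<close> still gives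
      \<le>.\<close>
    have p: "strict_prefix (shift s N u) (shift s N w)" using 2 by (intro strict_prefix_shift)
    then have sp: "length u < length w" "take (length u) (shift s N w) = shift s N u"
      by (simp_all add: strict_prefix_iff_take)
    have "last (shift s N u) = shift s N u ! (length u - 1)" using ne by (simp add: last_conv_nth)
    also have "\<dots> = take (length u) (shift s N w) ! (length u - 1)" by (simp only: sp)
    also have "\<dots> = shift s N w ! (length u - 1)" using ne by simp
    also have "\<dots> \<le> last (shift s N w)"
      using sp(1) by (intro sorted_nth_le_last sorted_shift s w) simp
    finally have "last (shift s N u) \<le> last (shift s N w)" .
    moreover have "(shift s N u, shift s N w) \<in> lexord less_than"
      using sp by (simp add: lexord_take_index_conv)
    ultimately show ?thesis using ne unfolding prec_def by (simp add: le_less)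
  next
    case (3 i)
    \<comment> \<open>The inequality at position i makes the common last entry positive, so both
      last entries move by N and stay equal.\<close>
    have "0 < w ! i" using 3 by simp
    also have "\<dots> \<le> last w" using 3 w by (intro sorted_nth_le_last)
    finally have l: "last (shift s N u) = last (shift s N w)" using 3 ne by (simp add: last_shift)
    have "i < length s \<Longrightarrow> s ! i \<le> N" using s(2) by auto
    then have "shift s N u ! i < shift s N w ! i" using 3 by (auto simp: nth_shift)
    moreover have "take i (shift s N u) = take i (shift s N w)" using 3 by (simp add: take_shift)
    ultimately have "(shift s N u, shift s N w) \<in> lexord less_than"
      unfolding lexord_take_index_conv using 3(2,3) by (intro disjI2 exI[of _ i]) simp
    then show ?thesis using l ne by (simp add: prec_def)
  qed
qed

lemma is_E_tree_shift:
  assumes "sorted s" "\<forall>x\<in>set s. x \<le> N"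
  shows "is_E_tree k (shift s N)"
  using assms sorted_shift prec_shift strict_prefix_shift
  by (auto simp: is_E_tree_def nondec_le_def)

lemma prec_lastI: "u \<noteq> [] \<Longrightarrow> w \<noteq> [] \<Longrightarrow> last u < last w \<Longrightarrow> prec u w"
  by (simp add: prec_def)

lemma prec_last_le: "prec u w \<Longrightarrow> u \<noteq> [] \<Longrightarrow> last u \<le> last w"
  by (auto simp: prec_def)

text \<open>Since \<open>prec\<close> compares last entries first, cutting the image of
  \<open>shift s N\<close> at last entry M leaves an initial segment, hence an
  \<open>r_approx\<close>. The last position lies after \<open>s\<close> because
  \<open>length s < k\<close>, so all last entries are at least N; \<open>N < M\<close> keeps the
  least element.\<close>

lemma AR_cover:
  assumes s: "sorted s" "\<forall>x\<in>set s. x \<le> N" and sk: "length s < k" and NM: "N < M"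
  shows "\<exists>E\<in>AR k. finite E \<and> E \<noteq> {} \<and> E \<subseteq> nondec_eq k \<and>
    (\<forall>v\<in>E. N \<le> last v \<and> last v < M) \<and>
    {v \<in> nondec_eq k. prefix s v \<and> N \<le> v ! length s \<and> last v < M} \<subseteq> E"
proof -
  define X where "X = shift s N ` nondec_eq k"
  define E where "E = {v \<in> X. last v < M}"
  have XE: "X \<in> E_space k"
    unfolding X_def E_space_def using is_E_tree_shift[OF s] by blast
  have Xk: "X \<subseteq> nondec_eq k" using sorted_shift[OF s] by (auto simp: X_def nondec_eq_def)
  then have ne: "v \<noteq> []" if "v \<in> X" for v using that sk by (auto simp: nondec_eq_def)
  have Xlast: "N \<le> last v" if "v \<in> X" for v
  proof -
    obtain u where u: "v = shift s N u" "length u = k" using \<open>v \<in> X\<close> by (auto simp: X_def nondec_eq_def)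
    then have "u \<noteq> []" using sk by auto
    then show ?thesis using u sk by (simp add: last_shift)
  qed
  have "E \<subseteq> {v. set v \<subseteq> {..M} \<and> length v \<le> k}"
  proof
    fix v assume "v \<in> E"
    then have v: "sorted v" "length v = k" "last v < M" using Xk by (auto simp: E_def nondec_eq_def)
    then have "x \<le> M" if "x \<in> set v" for x
      using that sorted_nth_le_last[of v] by (fastforce simp: in_set_conv_nth)
    then show "v \<in> {v. set v \<subseteq> {..M} \<and> length v \<le> k}" using v by auto
  qed
  then have fin: "finite E" using finite_lists_length_le[of "{..M}" k] finite_subset by blast
  have "replicate k 0 \<in> nondec_eq k" "replicate k (0::nat) \<noteq> []" using sk by (auto simp: nondec_eq_def)
  then have "shift s N (replicate k 0) \<in> E"
    using sk NM by (auto simp: E_def X_def last_shift)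
  then have Ene: "E \<noteq> {}" by blast
  have "r_approx (card E) X = E"
  proof (intro equalityI subsetI)
    fix v assume v: "v \<in> E"
    have "{t \<in> X. prec t v} \<subseteq> E - {v}"
    proof
      fix t assume "t \<in> {t \<in> X. prec t v}"
      then have t: "t \<in> X" "prec t v" by auto
      then have "t \<noteq> v" "last t \<le> last v" using prec_asym[of t v] prec_last_le ne by auto
      then show "t \<in> E - {v}" using t v by (simp add: E_def)
    qed
    then have "card {t \<in> X. prec t v} \<le> card (E - {v})" using fin by (intro card_mono) auto
    also have "\<dots> < card E" using v fin by (intro psubset_card_mono) auto
    finally show "v \<in> r_approx (card E) X" using v by (simp add: r_approx_def E_def)
  next
    fix v assume v: "v \<in> r_approx (card E) X"
    show "v \<in> E"
    proof (rule ccontr)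
      assume nv: "v \<notin> E"
      have vX: "v \<in> X" using v by (simp add: r_approx_def)
      have "E \<subseteq> {t \<in> X. prec t v}"
        using nv vX ne by (auto simp: E_def intro!: prec_lastI)
      moreover have "finite {t \<in> X. prec t v}"
        using Xk by (intro finite_subset[OF _ finite_prec[of k v]]) (auto simp: nondec_eq_def nondec_le_def)
      ultimately have "card E \<le> card {t \<in> X. prec t v}" by (intro card_mono)
      then show False using v by (simp add: r_approx_def)
    qed
  qed
  moreover have "1 \<le> card E" using fin Ene by (simp add: Suc_le_eq card_gt_0_iff)
  ultimately have "E \<in> AR k" using XE unfolding AR_def by blast
  moreover have "{v \<in> nondec_eq k. prefix s v \<and> N \<le> v ! length s \<and> last v < M} \<subseteq> E"
  proof
    fix v assume v: "v \<in> {v \<in> nondec_eq k. prefix s v \<and> N \<le> v ! length s \<and> last v < M}"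
    then have v: "sorted v" "length v = k" "prefix s v" "N \<le> v ! length s" "last v < M"
      by (auto simp: nondec_eq_def)
    \<comment> \<open>The preimage under \<open>shift s N\<close>: zero where \<open>v\<close>
      follows \<open>s\<close>, lowered by N afterwards. The subtraction does not truncate, because
      \<open>v\<close> is sorted and its entry after \<open>s\<close> is at least N.\<close>
    define u where "u = map (\<lambda>j. if j < length s then 0 else v ! j - N) [0..<k]"
    have vj: "N \<le> v ! j" if "length s \<le> j" "j < k" for j
      using v(1,2,4) that sorted_nth_mono[of v "length s" j] by auto
    have "v ! i \<le> v ! j" if "i \<le> j" "j < k" for i j
      using v that by (auto simp: sorted_iff_nth_mono)
    then have "sorted u" by (auto simp: u_def sorted_iff_nth_mono intro: diff_le_mono)
    then have "u \<in> nondec_eq k" by (simp add: nondec_eq_def u_def)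
    moreover have "shift s N u = v"
    proof (rule nth_equalityI)
      fix j assume "j < length (shift s N u)"
      then have j: "j < k" by (simp add: u_def)
      show "shift s N u ! j = v ! j"
      proof (cases "j < length s")
        case True
        then have "s ! j = v ! j" using v(3) by (auto simp: prefix_def nth_append)
        then show ?thesis using j True by (simp add: nth_shift u_def)
      next
        case False
        then show ?thesis using j vj[of j] by (simp add: nth_shift u_def)
      qed
    qed (use v in \<open>simp add: u_def\<close>)
    ultimately show "v \<in> E" using v(5) by (force simp: E_def X_def)
  qed
  ultimately show ?thesis using fin Ene Xk Xlast by (intro bexI[of _ E]) (auto simp: E_def)
qed

section \<open>Extreme elements of finite sets and successive sets\<close>

lemma prec_total: "a \<noteq> b \<Longrightarrow> a \<noteq> [] \<Longrightarrow> b \<noteq> [] \<Longrightarrow> prec a b \<or> prec b a"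
proof -
  assume "a \<noteq> b" "a \<noteq> []" "b \<noteq> []"
  moreover have "(a, b) \<in> lexord less_than \<or> a = b \<or> (b, a) \<in> lexord less_than"
    by (rule lexord_linear) auto
  ultimately show ?thesis by (auto simp: prec_def)
qed

lemma prec_Max_ex:
  "finite E \<Longrightarrow> E \<noteq> {} \<Longrightarrow> [] \<notin> E \<Longrightarrow> \<exists>a\<in>E. \<forall>e\<in>E. e = a \<or> prec e a"
proof (induction E rule: finite_ne_induct)
  case (insert x E)
  then obtain a where a: "a \<in> E" "\<forall>e\<in>E. e = a \<or> prec e a" by auto
  then have "x \<noteq> a" "a \<noteq> []" "x \<noteq> []" using insert by auto
  then consider "prec x a" | "prec a x" using prec_total by blast
  then show ?case
  proof cases
    case 1
    then show ?thesis using a by auto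
  next
    case 2
    then have "\<forall>e\<in>E. prec e x" using a(2) prec_trans[of _ a x] by auto
    then show ?thesis by auto
  qed
qed simp

lemma prec_Min_ex:
  "finite E \<Longrightarrow> E \<noteq> {} \<Longrightarrow> [] \<notin> E \<Longrightarrow> \<exists>a\<in>E. \<forall>e\<in>E. e = a \<or> prec a e"
proof (induction E rule: finite_ne_induct)
  case (insert x E)
  then obtain a where a: "a \<in> E" "\<forall>e\<in>E. e = a \<or> prec a e" by auto
  then have "x \<noteq> a" "a \<noteq> []" "x \<noteq> []" using insert by auto
  then consider "prec a x" | "prec x a" using prec_total by blast
  then show ?case
  proof cases
    case 1
    then show ?thesis using a by auto
  next
    case 2
    then have "\<forall>e\<in>E. prec x e" using a(2) prec_trans[of x a] by auto
    then show ?thesis by auto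
  qed
qed simp

lemma set_precI:
  assumes "finite E" "E \<noteq> {}" "finite F" "F \<noteq> {}" "[] \<notin> E" "[] \<notin> F"
    "\<And>a b. a \<in> E \<Longrightarrow> b \<in> F \<Longrightarrow> prec a b"
  shows "set_prec E F"
proof -
  obtain a where a: "a \<in> E" "\<forall>e\<in>E. e = a \<or> prec e a" using prec_Max_ex[of E] assms by auto
  obtain b where b: "b \<in> F" "\<forall>f\<in>F. f = b \<or> prec b f" using prec_Min_ex[of F] assms by auto
  show ?thesis unfolding set_prec_def
    by (rule bexI[OF _ a(1)], rule bexI[OF _ b(1)]) (use a b assms(7) in simp)
qed

context T_norm_params
begin

text \<open>This provides the hypothesis \<open>super\<close> of
  \<open>pnorm_le_superadditive\<close>. Each non-empty group is covered by a set from
  \<open>AR_cover\<close>, with bounds N at its least index and N after its greatest index, so the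
  covers are successive. A cover may catch more of the sum than its group, which only increases the
  norm.\<close>

lemma T_superadditive:
  fixes N :: "nat \<Rightarrow> nat"
  assumes s: "sorted s" "\<forall>x\<in>set s. x \<le> N 0" and sk: "length s < k" and N: "strict_mono N"
    and y: "\<And>i. y i \<in> c00 k"
    and supp: "\<And>i v. y i v \<noteq> 0 \<Longrightarrow> prefix s v \<and> N i \<le> v ! length s \<and> last v < N (Suc i)"
    and I: "finite I" and fI: "\<And>l. l < d \<Longrightarrow> f l \<subseteq> I"
    and ord: "\<And>l l' i i'. l < l' \<Longrightarrow> l' < d \<Longrightarrow> i \<in> f l \<Longrightarrow> i' \<in> f l' \<Longrightarrow> i < i'"
  shows "\<theta> * (\<Sum>l<d. T (\<lambda>v. \<Sum>i\<in>f l. y i v)) \<le> T (\<lambda>v. \<Sum>i\<in>I. y i v)"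
proof -
  define Y where "Y = (\<lambda>v. \<Sum>i\<in>I. y i v)"
  have Y: "Y \<in> c00 k" unfolding Y_def using I y by (intro c00_sum)
  \<comment> \<open>Empty groups are left out, because \<open>set_prec\<close> holds only for
    non-empty sets.\<close>
  define L where "L = filter (\<lambda>l. f l \<noteq> {}) [0..<d]"
  have finf: "finite (f l)" if "l < d" for l using fI[OF that] I finite_subset by blast
  have sN: "\<forall>x\<in>set s. x \<le> N i" for i
  proof -
    have "N 0 \<le> N i" using N by (simp add: strict_mono_less_eq)
    then show ?thesis using s(2) order_trans by blast
  qed
  have Nmono: "N i < N j \<longleftrightarrow> i < j" "N i \<le> N j \<longleftrightarrow> i \<le> j" for i j
    using N by (auto simp: strict_mono_less strict_mono_less_eq)
  have lastv: "N i \<le> last v" "v \<in> nondec_eq k" if "y i v \<noteq> 0" for i v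
  proof -
    show v: "v \<in> nondec_eq k" using c00_eq_0[OF y[of i]] that by blast
    then have "v ! length s \<le> last v" using sk by (intro sorted_nth_le_last) (auto simp: nondec_eq_def)
    then show "N i \<le> last v" using supp[OF that] by linarith
  qed
  have uniq: "i = j" if "y i v \<noteq> 0" "y j v \<noteq> 0" for i j v
  proof -
    have "N i < N (Suc j)" "N j < N (Suc i)"
      using lastv[OF that(1)] lastv[OF that(2)] supp[OF that(1)] supp[OF that(2)] by linarith+
    then show ?thesis by (simp add: Nmono)
  qed
  have "\<exists>E. E \<in> AR k \<and> finite E \<and> E \<noteq> {} \<and> E \<subseteq> nondec_eq k \<and>
      (\<forall>v\<in>E. N (Min (f l)) \<le> last v \<and> last v < N (Suc (Max (f l)))) \<and>
      {v \<in> nondec_eq k. prefix s v \<and> N (Min (f l)) \<le> v ! length s \<and> last v < N (Suc (Max (f l)))} \<subseteq> E"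
    if "l \<in> set L" for l
  proof -
    have l: "l < d" "f l \<noteq> {}" using that by (auto simp: L_def)
    then have "Min (f l) \<le> Max (f l)" by (intro Min_le Max_in finf)
    then have "N (Min (f l)) < N (Suc (Max (f l)))" by (simp add: Nmono)
    then show ?thesis by (rule AR_cover[OF s(1) sN sk, unfolded Bex_def])
  qed
  then have "\<forall>l\<in>set L. \<exists>E. E \<in> AR k \<and> finite E \<and> E \<noteq> {} \<and> E \<subseteq> nondec_eq k \<and>
      (\<forall>v\<in>E. N (Min (f l)) \<le> last v \<and> last v < N (Suc (Max (f l)))) \<and>
      {v \<in> nondec_eq k. prefix s v \<and> N (Min (f l)) \<le> v ! length s \<and> last v < N (Suc (Max (f l)))} \<subseteq> E"
    by (rule ballI)
  from bchoice[OF this] obtain E where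
    E': "\<forall>l\<in>set L. E l \<in> AR k \<and> finite (E l) \<and> E l \<noteq> {} \<and> E l \<subseteq> nondec_eq k \<and>
      (\<forall>v\<in>E l. N (Min (f l)) \<le> last v \<and> last v < N (Suc (Max (f l)))) \<and>
      {v \<in> nondec_eq k. prefix s v \<and> N (Min (f l)) \<le> v ! length s \<and> last v < N (Suc (Max (f l)))} \<subseteq> E l" ..
  have E: "E l \<in> AR k" "finite (E l)" "E l \<noteq> {}" "E l \<subseteq> nondec_eq k"
      "\<forall>v\<in>E l. N (Min (f l)) \<le> last v \<and> last v < N (Suc (Max (f l)))"
      "{v \<in> nondec_eq k. prefix s v \<and> N (Min (f l)) \<le> v ! length s \<and> last v < N (Suc (Max (f l)))} \<subseteq> E l"
    if "l \<in> set L" for l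
    using bspec[OF E' that] by - (elim conjE, assumption)+
  have "(\<Sum>l<d. T (\<lambda>v. \<Sum>i\<in>f l. y i v)) = (\<Sum>l\<leftarrow>[0..<d]. T (\<lambda>v. \<Sum>i\<in>f l. y i v))"
    by (simp add: interv_sum_list_conv_sum_set_nat atLeast0LessThan)
  also have "\<dots> = (\<Sum>l\<leftarrow>L. T (\<lambda>v. \<Sum>i\<in>f l. y i v))"
    unfolding L_def by (subst sum_list_map_filter) (auto simp: T_zero)
  also have "\<dots> \<le> (\<Sum>l\<leftarrow>L. T (proj (E l) Y))"
  proof (rule sum_list_mono)
    fix l assume l: "l \<in> set L"
    then have ld: "l < d" "f l \<noteq> {}" by (auto simp: L_def)
    show "T (\<lambda>v. \<Sum>i\<in>f l. y i v) \<le> T (proj (E l) Y)"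
    proof (rule T_mono)
      show "(\<lambda>v. \<Sum>i\<in>f l. y i v) \<in> c00 k" using finf[OF ld(1)] y by (intro c00_sum)
      show "proj (E l) Y \<in> c00 k" using Y by (rule proj_c00)
      fix v
      show "\<bar>\<Sum>i\<in>f l. y i v\<bar> \<le> \<bar>proj (E l) Y v\<bar>"
      proof (cases "\<exists>i\<in>f l. y i v \<noteq> 0")
        case True
        then obtain i where i: "i \<in> f l" "y i v \<noteq> 0" by blast
        have "(\<Sum>j\<in>J. y j v) = y i v" if "finite J" "i \<in> J" for J
        proof -
          have "(\<Sum>j\<in>J - {i}. y j v) = 0" using uniq[OF i(2)] by (intro sum.neutral) blast
          then show ?thesis using that by (simp add: sum.remove)
        qed
        then have eq: "(\<Sum>i\<in>f l. y i v) = Y v" using finf[OF ld(1)] fI[OF ld(1)] I i by (auto simp: Y_def)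
        have "Min (f l) \<le> i" "i \<le> Max (f l)" using i finf[OF ld(1)] by auto
        then have "N (Min (f l)) \<le> N i" "N (Suc i) \<le> N (Suc (Max (f l)))" by (simp_all add: Nmono)
        then have "v \<in> {v \<in> nondec_eq k. prefix s v \<and> N (Min (f l)) \<le> v ! length s \<and> last v < N (Suc (Max (f l)))}"
          using supp[OF i(2)] lastv(2)[OF i(2)] by auto
        then have "v \<in> E l" using E(6)[OF l] by blast
        then show ?thesis by (simp add: proj_def eq)
      qed (simp add: sum.neutral)
    qed
  qed
  also have "\<theta> * \<dots> \<le> T Y"
  proof (cases "L = []")
    case True
    then show ?thesis using T_nonneg[OF Y] by simp
  next
    case False
    have "admissible k d (map E L)"
      unfolding admissible_def
    proof (intro conjI)
      show "1 \<le> length (map E L)" using False by (simp add: Suc_le_eq)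
      show "length (map E L) \<le> d" using length_filter_le[of _ "[0..<d]"] by (simp add: L_def)
      show "set (map E L) \<subseteq> AR k" using E(1) by auto
      have "sorted_wrt (<) L" unfolding L_def by (intro sorted_wrt_filter) simp
      then show "sorted_wrt set_prec (map E L)"
        unfolding sorted_wrt_map
      proof (rule sorted_wrt_mono_rel[rotated])
        fix l l' assume l: "l \<in> set L" "l' \<in> set L" "l < l'"
        then have fl: "l < d" "l' < d" "f l \<noteq> {}" "f l' \<noteq> {}" by (auto simp: L_def)
        have "Max (f l) < Min (f l')"
          by (rule ord[OF l(3) fl(2) Max_in[OF finf[OF fl(1)] fl(3)] Min_in[OF finf[OF fl(2)] fl(4)]])
        then have le: "N (Suc (Max (f l))) \<le> N (Min (f l'))" by (simp add: Nmono)
        have nil: "[] \<notin> E l" "[] \<notin> E l'" using E(4)[OF l(1)] E(4)[OF l(2)] sk by (auto simp: nondec_eq_def)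
        show "set_prec (E l) (E l')"
        proof (rule set_precI)
          fix a b assume ab: "a \<in> E l" "b \<in> E l'"
          have "last a < N (Suc (Max (f l)))" using bspec[OF E(5)[OF l(1)] ab(1)] by simp
          also note le
          also have "N (Min (f l')) \<le> last b" using bspec[OF E(5)[OF l(2)] ab(2)] by simp
          finally have "last a < last b" .
          moreover have "a \<noteq> []" "b \<noteq> []" using nil ab by metis+
          ultimately show "prec a b" by (simp add: prec_lastI)
        qed (use E(2,3)[OF l(1)] E(2,3)[OF l(2)] nil in simp_all)
      qed
    qed
    from T_admissible[OF Y this] show ?thesis by (simp add: o_def)
  qed
  finally show ?thesis using \<theta> by (simp add: Y_def)
qed

end

section \<open>Sequences equivalent to the unit vector basis of $\ell_p$\<close>

lemma pnorm_le_lp_norm: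
  assumes p: "0 < p" and a: "a \<in> lp p" and I: "finite I"
  shows "pnorm p a I \<le> lp_norm p a"
  unfolding pnorm_def lp_norm_def using p a I
  by (intro powr_mono2 sum_le_suminf sum_nonneg) (auto simp: lp_def)

lemma pnorm_tendsto_lp_norm:
  assumes p: "0 < p" and a: "a \<in> lp p"
  shows "(\<lambda>n. pnorm p a {..<n}) \<longlonglongrightarrow> lp_norm p a"
  unfolding pnorm_def lp_norm_def using p a
  by (intro tendsto_powr' summable_LIMSEQ tendsto_const) (auto simp: lp_def sum_nonneg)

lemma lp_zero: "(\<lambda>n. 0) \<in> lp p"
  by (simp add: lp_def)

lemma lp_cmult: "a \<in> lp p \<Longrightarrow> (\<lambda>n. c * a n) \<in> lp p"
  by (auto simp: lp_def abs_mult powr_mult intro: summable_mult)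

lemma lp_diff:
  assumes "1 \<le> p" "a \<in> lp p" "b \<in> lp p"
  shows "(\<lambda>n. a n - b n) \<in> lp p"
  using lp_triangle(1)[OF assms(1,2) lp_cmult[OF assms(3), of "-1"]] by simp

lemma lp_memI:
  assumes p: "0 < p" and B: "\<And>n. pnorm p a {..<n} \<le> B"
  shows "a \<in> lp p" "lp_norm p a \<le> B"
proof -
  have "(\<Sum>i<n. \<bar>a i\<bar> powr p) \<le> B powr p" for n
    using powr_mono2[OF _ _ B[of n], of p] p by (simp add: pnorm_powr)
  then have "summable (\<lambda>n. \<bar>a n\<bar> powr p)" by (intro summableI_nonneg_bounded) auto
  then show a: "a \<in> lp p" by (simp add: lp_def)
  show "lp_norm p a \<le> B"
    using pnorm_tendsto_lp_norm[OF p a] B by (intro LIMSEQ_le_const2) auto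
qed

text \<open>Coordinates converge, and bounds on finitely many coordinates pass to the limit. This
  serves to show that the image of l_p is closed.\<close>

lemma lp_complete:
  assumes p: "1 \<le> p" and A: "\<And>n. A n \<in> lp p"
    and cauchy: "\<And>e. 0 < e \<Longrightarrow> \<exists>N. \<forall>m\<ge>N. \<forall>n\<ge>N. lp_norm p (\<lambda>i. A n i - A m i) < e"
  obtains a where "a \<in> lp p" "(\<lambda>n. lp_norm p (\<lambda>i. A n i - a i)) \<longlonglongrightarrow> 0"
proof -
  have p0: "0 < p" using p by simp
  have D: "(\<lambda>i. A n i - A m i) \<in> lp p" for n m by (intro lp_diff p A)
  have coord: "\<bar>A n i - A m i\<bar> \<le> lp_norm p (\<lambda>i. A n i - A m i)" for n m i
    using abs_le_pnorm[OF p0, of "{i}" i "\<lambda>i. A n i - A m i"] pnorm_le_lp_norm[OF p0 D, of "{i}" n m]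
    by simp
  have "Cauchy (\<lambda>n. A n i)" for i
  proof (rule metric_CauchyI)
    fix e :: real assume "0 < e"
    then obtain N where "\<forall>m\<ge>N. \<forall>n\<ge>N. lp_norm p (\<lambda>i. A n i - A m i) < e" using cauchy by blast
    then have "dist (A m i) (A n i) < e" if "m \<ge> N" "n \<ge> N" for m n
      unfolding dist_real_def using that by (intro le_less_trans[OF coord]) blast
    then show "\<exists>N. \<forall>m\<ge>N. \<forall>n\<ge>N. dist (A m i) (A n i) < e" by blast
  qed
  then have "\<forall>i. \<exists>L. (\<lambda>n. A n i) \<longlonglongrightarrow> L"
    using Cauchy_convergent_iff unfolding convergent_def by blast
  then obtain a where a: "\<And>i. (\<lambda>n. A n i) \<longlonglongrightarrow> a i" by metis
  have lim: "(\<lambda>i. A n i - a i) \<in> lp p \<and> lp_norm p (\<lambda>i. A n i - a i) \<le> e"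
    if N: "\<forall>m\<ge>N. \<forall>n\<ge>N. lp_norm p (\<lambda>i. A n i - A m i) < e" and n: "n \<ge> N" for n N e
  proof -
    have "pnorm p (\<lambda>i. A n i - a i) {..<K} \<le> e" for K
    proof (rule LIMSEQ_le_const2)
      show "(\<lambda>m. pnorm p (\<lambda>i. A n i - A m i) {..<K}) \<longlonglongrightarrow> pnorm p (\<lambda>i. A n i - a i) {..<K}"
        unfolding pnorm_def using p0
        by (intro tendsto_powr' tendsto_sum tendsto_rabs tendsto_diff tendsto_const a)
          (auto simp: sum_nonneg)
      show "\<exists>N. \<forall>m\<ge>N. pnorm p (\<lambda>i. A n i - A m i) {..<K} \<le> e"
      proof (intro exI[of _ N] allI impI)
        fix m assume "m \<ge> N"
        then have "lp_norm p (\<lambda>i. A n i - A m i) < e" using N n by blast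
        then show "pnorm p (\<lambda>i. A n i - A m i) {..<K} \<le> e"
          using pnorm_le_lp_norm[OF p0 D, of "{..<K}" n m] by simp
      qed
    qed
    then show ?thesis using lp_memI[OF p0] by blast
  qed
  obtain N1 where "\<forall>m\<ge>N1. \<forall>n\<ge>N1. lp_norm p (\<lambda>i. A n i - A m i) < 1" using cauchy[of 1] by auto
  then have "(\<lambda>i. A N1 i - a i) \<in> lp p" using lim by blast
  from lp_diff[OF p A[of N1] this] have "a \<in> lp p" by simp
  moreover have "(\<lambda>n. lp_norm p (\<lambda>i. A n i - a i)) \<longlonglongrightarrow> 0"
  proof (rule metric_LIMSEQ_I)
    fix e :: real assume "0 < e"
    then obtain N where "\<forall>m\<ge>N. \<forall>n\<ge>N. lp_norm p (\<lambda>i. A n i - A m i) < e/2"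
      using cauchy[of "e/2"] by auto
    then have "lp_norm p (\<lambda>i. A n i - a i) \<le> e/2" if "n \<ge> N" for n using lim that by blast
    moreover have "\<bar>lp_norm p x\<bar> = lp_norm p x" for x by (simp add: lp_norm_def)
    ultimately have "dist (lp_norm p (\<lambda>i. A n i - a i)) 0 < e" if "n \<ge> N" for n
      using \<open>0 < e\<close> that by (simp add: le_less_trans[of _ "e/2"])
    then show "\<exists>N. \<forall>n\<ge>N. dist (lp_norm p (\<lambda>i. A n i - a i)) 0 < e" by blast
  qed
  ultimately show ?thesis by (rule that)
qed

lemma Metric_space_dist_subset: "Metric_space Y (dist :: 'b::metric_space \<Rightarrow> _)"
  by (simp add: Met_TC.subspace)

lemma mtopology_dist_subset: "Metric_space.mtopology Y (dist :: 'b::metric_space \<Rightarrow> _) = top_of_set Y"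
proof -
  interpret Submetric UNIV dist Y by unfold_locales simp
  show ?thesis by (simp add: mtopology_submetric)
qed

text \<open>The upper estimate makes the series with coefficients in l_p converge to a bounded
  operator U. The lower estimate makes U bounded below, so its range is closed and its inverse is
  continuous.\<close>

lemma lp_isomorphism:
  fixes z :: "nat \<Rightarrow> 'b::banach"
  assumes p: "1 < p" and c: "0 < c"
    and lower: "\<And>I a. finite I \<Longrightarrow> c * pnorm p a I \<le> norm (\<Sum>i\<in>I. a i *\<^sub>R z i)"
    and upper: "\<And>I a. finite I \<Longrightarrow> norm (\<Sum>i\<in>I. a i *\<^sub>R z i) \<le> C * pnorm p a I"
    and Z: "subspace Z" "closed Z" "\<And>i. z i \<in> Z"
  shows "\<exists>Y. Y \<subseteq> Z \<and> subspace Y \<and> closed Y \<and> isomorphic_to_lp p Y"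
proof -
  have p0: "0 < p" and p1: "1 \<le> p" using p by auto
  \<comment> \<open>Comparing both estimates at a single index gives c \<le> C.\<close>
  have "c * pnorm p (\<lambda>_. 1) {0::nat} \<le> C * pnorm p (\<lambda>_. 1) {0::nat}"
    by (rule order_trans[OF lower upper]) auto
  then have C: "0 < C" using c by (simp add: pnorm_def)
  define U where "U a = (\<Sum>n. a n *\<^sub>R z n)" for a
  have summ: "summable (\<lambda>n. a n *\<^sub>R z n)" if a: "a \<in> lp p" for a
    unfolding summable_Cauchy
  proof (intro allI impI)
    fix e :: real assume "0 < e"
    then have "0 < (e / C) powr p" using C by simp
    then obtain N where N: "\<And>m n. m \<ge> N \<Longrightarrow> norm (\<Sum>i=m..<n. \<bar>a i\<bar> powr p) < (e / C) powr p"
      using a unfolding lp_def summable_Cauchy by blast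
    have "norm (\<Sum>i=m..<n. a i *\<^sub>R z i) < e" if "m \<ge> N" for m n
    proof -
      have "pnorm p a {m..<n} < ((e / C) powr p) powr (1 / p)"
        unfolding pnorm_def using N[OF that, of n] p0 by (intro powr_less_mono2) (auto simp: sum_nonneg)
      also have "\<dots> = e / C" using p0 C \<open>0 < e\<close> by (simp add: powr_powr)
      finally have "C * pnorm p a {m..<n} < e" using C by (simp add: field_simps)
      then show ?thesis using upper[of "{m..<n}" a] by simp
    qed
    then show "\<exists>N. \<forall>m\<ge>N. \<forall>n. norm (\<Sum>i=m..<n. a i *\<^sub>R z i) < e" by blast
  qed
  have Ulim: "(\<lambda>n. \<Sum>i<n. a i *\<^sub>R z i) \<longlonglongrightarrow> U a" if "a \<in> lp p" for a
    unfolding U_def by (rule summable_LIMSEQ[OF summ[OF that]])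
  have U_lower: "c * lp_norm p a \<le> norm (U a)" if a: "a \<in> lp p" for a
    using lower by (intro LIMSEQ_le[OF tendsto_mult_left[OF pnorm_tendsto_lp_norm[OF p0 a]]
        tendsto_norm[OF Ulim[OF a]]]) auto
  have U_upper: "norm (U a) \<le> C * lp_norm p a" if a: "a \<in> lp p" for a
    using upper by (intro LIMSEQ_le[OF tendsto_norm[OF Ulim[OF a]]
        tendsto_mult_left[OF pnorm_tendsto_lp_norm[OF p0 a]]]) auto
  have UZ: "U a \<in> Z" if a: "a \<in> lp p" for a
    using Z by (intro closed_sequentially[OF Z(2) _ Ulim[OF a]] subspace_sum subspace_scale) auto
  have U_add: "U (\<lambda>n. a n + b n) = U a + U b" if "a \<in> lp p" "b \<in> lp p" for a b
    unfolding U_def using suminf_add[OF summ[OF that(1)] summ[OF that(2)]]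
    by (simp add: scaleR_add_left)
  have U_cmult: "U (\<lambda>n. r * a n) = r *\<^sub>R U a" if "a \<in> lp p" for a r
    unfolding U_def using suminf_scaleR_right[OF summ[OF that], of r] by simp
  have U_diff: "U (\<lambda>n. a n - b n) = U a - U b" if "a \<in> lp p" "b \<in> lp p" for a b
    using U_add[OF that(1) lp_cmult[OF that(2), of "-1"]] U_cmult[OF that(2), of "-1"] by simp
  have dist_lower: "c * lp_norm p (\<lambda>n. a n - b n) \<le> dist (U a) (U b)" if "a \<in> lp p" "b \<in> lp p" for a b
    using U_lower[OF lp_diff[OF p1 that]] by (simp add: U_diff[OF that] dist_norm)
  have dist_upper: "dist (U a) (U b) \<le> C * lp_norm p (\<lambda>n. a n - b n)" if "a \<in> lp p" "b \<in> lp p" for a b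
    using U_upper[OF lp_diff[OF p1 that]] by (simp add: U_diff[OF that] dist_norm)
  define Y where "Y = U ` lp p"
  have "subspace Y"
    unfolding subspace_def
  proof (intro conjI ballI allI)
    have "U (\<lambda>n. 0) = 0" by (simp add: U_def)
    then show "0 \<in> Y" using lp_zero unfolding Y_def by (metis imageI)
    fix x y assume "x \<in> Y" "y \<in> Y"
    then obtain a b where ab: "a \<in> lp p" "b \<in> lp p" "x = U a" "y = U b" by (auto simp: Y_def)
    show "x + y \<in> Y" unfolding Y_def
      using lp_triangle(1)[OF p1 ab(1,2)] U_add[OF ab(1,2)] ab by (metis imageI)
  next
    fix r x assume "x \<in> Y"
    then obtain a where a: "a \<in> lp p" "x = U a" by (auto simp: Y_def)
    then show "r *\<^sub>R x \<in> Y" unfolding Y_def using lp_cmult[OF a(1), of r] U_cmult[OF a(1), of r] by (metis imageI)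
  qed
  moreover have "closed Y"
    unfolding closed_sequential_limits
  proof (intro allI impI)
    fix x l assume x: "(\<forall>n. x n \<in> Y) \<and> x \<longlonglongrightarrow> l"
    then have "\<forall>n. \<exists>a. a \<in> lp p \<and> x n = U a" by (auto simp: Y_def)
    then obtain A where A: "\<And>n. A n \<in> lp p" "\<And>n. x n = U (A n)" by metis
    have "Cauchy x" using x LIMSEQ_imp_Cauchy by blast
    have cauchy: "\<exists>N. \<forall>m\<ge>N. \<forall>n\<ge>N. lp_norm p (\<lambda>i. A n i - A m i) < e" if "0 < e" for e
    proof -
      have "0 < c * e" using c that by simp
      from metric_CauchyD[OF \<open>Cauchy x\<close> this] obtain N
        where N: "\<And>m n. m \<ge> N \<Longrightarrow> n \<ge> N \<Longrightarrow> dist (x m) (x n) < c * e" by blast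
      have "lp_norm p (\<lambda>i. A n i - A m i) < e" if "m \<ge> N" "n \<ge> N" for m n
      proof -
        have "c * lp_norm p (\<lambda>i. A n i - A m i) < c * e"
          using dist_lower[OF A(1)[of n] A(1)[of m]] N[OF that(2,1)] by (simp add: A(2))
        then show ?thesis using c by simp
      qed
      then show ?thesis by blast
    qed
    obtain a where a: "a \<in> lp p" "(\<lambda>n. lp_norm p (\<lambda>i. A n i - a i)) \<longlonglongrightarrow> 0"
      using lp_complete[where A = A, OF p1 A(1) cauchy] .
    have "(\<lambda>n. dist (x n) (U a)) \<longlonglongrightarrow> 0"
    proof (rule tendsto_0_le[where K = C, OF a(2)], rule always_eventually, rule allI)
      fix n
      have "dist (x n) (U a) \<le> C * lp_norm p (\<lambda>i. A n i - a i)"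
        using dist_upper[OF A(1)[of n] a(1)] unfolding A(2)[of n] .
      moreover have "norm (lp_norm p (\<lambda>i. A n i - a i)) = lp_norm p (\<lambda>i. A n i - a i)"
        by (simp add: lp_norm_def)
      ultimately show "norm (dist (x n) (U a)) \<le> norm (lp_norm p (\<lambda>i. A n i - a i)) * C"
        by (simp add: mult.commute)
    qed
    then have "x \<longlonglongrightarrow> U a" by (subst tendsto_dist_iff)
    then have "l = U a" using x LIMSEQ_unique by blast
    then show "l \<in> Y" using a(1) by (simp add: Y_def)
  qed
  moreover have "isomorphic_to_lp p Y"
    unfolding isomorphic_to_lp_def
  proof (intro exI[of _ U] conjI ballI allI U_add U_cmult)
    interpret L: Metric_space "lp p" "\<lambda>a b. lp_norm p (\<lambda>n. a n - b n)" by (rule Metric_space_lp[OF p1])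
    interpret Y: Metric_space Y dist by (rule Metric_space_dist_subset)
    have inj: "inj_on U (lp p)"
    proof (rule inj_onI)
      fix a b assume ab: "a \<in> lp p" "b \<in> lp p" "U a = U b"
      then have "c * lp_norm p (\<lambda>n. a n - b n) \<le> 0" using dist_lower[OF ab(1,2)] by simp
      then have "lp_norm p (\<lambda>n. a n - b n) = 0"
        using c L.nonneg[of a b] by (simp add: mult_le_0_iff)
      then show "a = b" using L.zero ab by blast
    qed
    define V where "V = inv_into (lp p) U"
    have V: "V y \<in> lp p" "U (V y) = y" if "y \<in> Y" for y
      using that unfolding V_def Y_def by (simp_all only: inv_into_into f_inv_into_f)
    have VU: "V (U a) = a" if "a \<in> lp p" for a
      using that inj by (simp add: V_def)
    have "continuous_map L.mtopology Y.mtopology U"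
      unfolding L.metric_continuous_map[OF Metric_space_dist_subset]
    proof (intro conjI ballI allI impI)
      show "U ` lp p \<subseteq> Y" by (simp add: Y_def)
      fix a and e :: real assume a: "a \<in> lp p" and e: "0 < e"
      have "dist (U a) (U x) < e" if "x \<in> lp p" "lp_norm p (\<lambda>n. a n - x n) < e / C" for x
        using dist_upper[OF a that(1)] that(2) C by (simp add: field_simps)
      then show "\<exists>\<delta>>0. \<forall>x. x \<in> lp p \<and> lp_norm p (\<lambda>n. a n - x n) < \<delta> \<longrightarrow> dist (U a) (U x) < e"
        using e C by (intro exI[of _ "e / C"]) auto
    qed
    moreover have "continuous_map Y.mtopology L.mtopology V"
      unfolding Y.metric_continuous_map[OF L.Metric_space_axioms]
    proof (intro conjI ballI allI impI)
      show "V ` Y \<subseteq> lp p" using V by auto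
      fix y and e :: real assume y: "y \<in> Y" and e: "0 < e"
      have "lp_norm p (\<lambda>n. V y n - V x n) < e" if "x \<in> Y" "dist y x < c * e" for x
      proof -
        have "c * lp_norm p (\<lambda>n. V y n - V x n) < c * e"
          using dist_lower[OF V(1)[OF y] V(1)[OF that(1)]] that V(2) y by simp
        then show ?thesis using c by simp
      qed
      then show "\<exists>\<delta>>0. \<forall>x. x \<in> Y \<and> dist y x < \<delta> \<longrightarrow> lp_norm p (\<lambda>n. V y n - V x n) < e"
        using e c by (intro exI[of _ "c * e"]) auto
    qed
    ultimately have "homeomorphic_maps L.mtopology Y.mtopology U V"
      unfolding homeomorphic_maps_def using V VU by simp
    then show "homeomorphic_map (lp_topology p) (top_of_set Y) U"
      using homeomorphic_maps_map by (auto simp: lp_topology_def mtopology_dist_subset)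
  qed
  moreover have "Y \<subseteq> Z" using UZ by (auto simp: Y_def)
  ultimately show ?thesis by blast
qed

section \<open>Block sequences in subspaces of the completion\<close>

lemma c00_add: "x \<in> c00 k \<Longrightarrow> y \<in> c00 k \<Longrightarrow> (\<lambda>v. x v + y v) \<in> c00 k"
  using c00_sum[of "{True, False}" "\<lambda>b. if b then x else y" k] by simp

lemma c00_cmult: "x \<in> c00 k \<Longrightarrow> (\<lambda>v. c * x v) \<in> c00 k"
  by (auto simp: c00_def elim: rev_finite_subset)

lemma c00_zero: "(\<lambda>v. 0) \<in> c00 k"
  by (simp add: c00_def)

lemma c00_last_bound:
  assumes "x \<in> c00 k"
  obtains M where "\<And>v. x v \<noteq> 0 \<Longrightarrow> last v < M"
proof -
  have "finite (last ` {v. x v \<noteq> 0})" using assms by (simp add: c00_def)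
  then obtain M where "\<forall>n\<in>last ` {v. x v \<noteq> 0}. n < M" using finite_nat_set_iff_bounded by blast
  then show ?thesis by (intro that[of M]) auto
qed

locale T_space = T_norm_params k d \<theta> for k d \<theta> +
  fixes J :: "(nat list \<Rightarrow> real) \<Rightarrow> 'b::banach" and TT :: "'b set"
  assumes T_space: "is_T_space k d \<theta> J TT"
begin

lemma J_add: "x \<in> c00 k \<Longrightarrow> y \<in> c00 k \<Longrightarrow> J (\<lambda>v. x v + y v) = J x + J y"
  and J_cmult: "x \<in> c00 k \<Longrightarrow> J (\<lambda>v. c * x v) = c *\<^sub>R J x"
  and norm_J: "x \<in> c00 k \<Longrightarrow> norm (J x) = T x"
  and TT: "TT = closure (J ` c00 k)"
  using T_space by (auto simp: is_T_space_def is_completion_def)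

lemma J_zero: "J (\<lambda>v. 0) = 0"
  using J_cmult[OF c00_zero, of 0] by simp

lemma J_sum:
  assumes "finite I" "\<And>i. i \<in> I \<Longrightarrow> x i \<in> c00 k"
  shows "J (\<lambda>v. \<Sum>i\<in>I. a i * x i v) = (\<Sum>i\<in>I. a i *\<^sub>R J (x i))"
  using assms
proof (induction I rule: finite_induct)
  case (insert i I)
  have "(\<lambda>v. \<Sum>i\<in>I. a i * x i v) \<in> c00 k"
    using insert by (intro c00_sum c00_cmult) auto
  moreover have "(\<lambda>v. a i * x i v) \<in> c00 k" using insert by (intro c00_cmult) auto
  ultimately show ?case using insert J_cmult[of "x i" "a i"] by (simp add: J_add)
qed (simp add: J_zero)

lemma J_diff: "x \<in> c00 k \<Longrightarrow> y \<in> c00 k \<Longrightarrow> J (\<lambda>v. x v - c * y v) = J x - c *\<^sub>R J y"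
  using J_add[of x "\<lambda>v. - c * y v"] J_cmult[of y "- c"] c00_cmult[of y k "- c"] by simp

lemma c00_diff: "x \<in> c00 k \<Longrightarrow> y \<in> c00 k \<Longrightarrow> (\<lambda>v. x v - c * y v) \<in> c00 k"
  using c00_add[of x k "\<lambda>v. - c * y v"] c00_cmult[of y k "- c"] by simp

lemma T_cmult: "x \<in> c00 k \<Longrightarrow> T (\<lambda>v. c * x v) = \<bar>c\<bar> * T x"
  using norm_J[OF c00_cmult[of x k c]] J_cmult[of x c] norm_J[of x] by simp

lemma T_add_le: "x \<in> c00 k \<Longrightarrow> y \<in> c00 k \<Longrightarrow> T (\<lambda>v. x v + y v) \<le> T x + T y"
  using norm_J[OF c00_add[of x k y]] J_add[of x y] norm_J[of x] norm_J[of y]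
    norm_triangle_ineq[of "J x" "J y"] by simp

lemma T_sum_le:
  assumes "finite I" "\<And>i. i \<in> I \<Longrightarrow> x i \<in> c00 k"
  shows "T (\<lambda>v. \<Sum>i\<in>I. x i v) \<le> (\<Sum>i\<in>I. T (x i))"
  using assms
proof (induction I rule: finite_induct)
  case (insert i I)
  have "T (\<lambda>v. x i v + (\<Sum>i\<in>I. x i v)) \<le> T (x i) + T (\<lambda>v. \<Sum>i\<in>I. x i v)"
    using insert by (intro T_add_le c00_sum) auto
  then show ?case using insert by simp
qed (simp add: T_zero)

text \<open>Elements of the completion are not functions, so "the coordinates in A vanish" is
  expressed by approximation with finitely supported vectors vanishing on A.\<close>

definition off :: "nat list set \<Rightarrow> 'b set" where
  "off A = closure (J ` {x \<in> c00 k. \<forall>v\<in>A. x v = 0})"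

lemma off_empty: "off {} = TT"
  by (simp add: off_def TT)

lemma off_antimono: "A \<subseteq> B \<Longrightarrow> off B \<subseteq> off A"
  unfolding off_def by (intro closure_mono) auto

lemma off_sequence:
  assumes "z \<in> off A"
  shows "\<exists>x. (\<forall>n. x n \<in> c00 k) \<and> (\<forall>n. \<forall>v\<in>A. x n v = 0) \<and> (\<lambda>n. J (x n)) \<longlonglongrightarrow> z"
proof -
  obtain y where y: "\<forall>n. y n \<in> J ` {x \<in> c00 k. \<forall>v\<in>A. x v = 0}" "y \<longlonglongrightarrow> z"
    using assms unfolding off_def closure_sequential by blast
  then have "\<forall>n. \<exists>x. x \<in> c00 k \<and> (\<forall>v\<in>A. x v = 0) \<and> y n = J x" by blast
  from choice[OF this] obtain x
    where x: "\<forall>n. x n \<in> c00 k \<and> (\<forall>v\<in>A. x n v = 0) \<and> y n = J (x n)" ..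
  then have "y = (\<lambda>n. J (x n))" by auto
  then show ?thesis using x y(2) by (intro exI[of _ x]) auto
qed

lemma offI:
  assumes "\<And>n. x n \<in> c00 k" "\<And>n v. v \<in> A \<Longrightarrow> x n v = 0" "(\<lambda>n. J (x n)) \<longlonglongrightarrow> z"
  shows "z \<in> off A"
  unfolding off_def closure_sequential
  by (rule exI[of _ "\<lambda>n. J (x n)"]) (use assms in auto)

lemma off_scale:
  assumes "z \<in> off A" shows "c *\<^sub>R z \<in> off A"
proof -
  obtain x where "\<forall>n. x n \<in> c00 k" "\<forall>n. \<forall>v\<in>A. x n v = 0" "(\<lambda>n. J (x n)) \<longlonglongrightarrow> z"
    using off_sequence[OF assms] by (elim exE conjE)
  then have x: "\<And>n. x n \<in> c00 k" "\<And>n v. v \<in> A \<Longrightarrow> x n v = 0" "(\<lambda>n. J (x n)) \<longlonglongrightarrow> z"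
    by blast+
  show ?thesis
  proof (rule offI[of "\<lambda>n v. c * x n v"])
    have "(\<lambda>n. c *\<^sub>R J (x n)) \<longlonglongrightarrow> c *\<^sub>R z" using x(3) by (intro tendsto_intros)
    then show "(\<lambda>n. J (\<lambda>v. c * x n v)) \<longlonglongrightarrow> c *\<^sub>R z" using x(1) by (simp add: J_cmult)
  qed (use x in \<open>auto intro: c00_cmult\<close>)
qed

lemma off_add:
  assumes "z \<in> off A" "z' \<in> off A" shows "z + z' \<in> off A"
proof -
  obtain x where "\<forall>n. x n \<in> c00 k" "\<forall>n. \<forall>v\<in>A. x n v = 0" "(\<lambda>n. J (x n)) \<longlonglongrightarrow> z"
    using off_sequence[OF assms(1)] by (elim exE conjE)
  then have x: "\<And>n. x n \<in> c00 k" "\<And>n v. v \<in> A \<Longrightarrow> x n v = 0" "(\<lambda>n. J (x n)) \<longlonglongrightarrow> z"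
    by blast+
  obtain y where "\<forall>n. y n \<in> c00 k" "\<forall>n. \<forall>v\<in>A. y n v = 0" "(\<lambda>n. J (y n)) \<longlonglongrightarrow> z'"
    using off_sequence[OF assms(2)] by (elim exE conjE)
  then have y: "\<And>n. y n \<in> c00 k" "\<And>n v. v \<in> A \<Longrightarrow> y n v = 0" "(\<lambda>n. J (y n)) \<longlonglongrightarrow> z'"
    by blast+
  show ?thesis
  proof (rule offI[of "\<lambda>n v. x n v + y n v"])
    have "(\<lambda>n. J (x n) + J (y n)) \<longlonglongrightarrow> z + z'" using x(3) y(3) by (intro tendsto_intros)
    then show "(\<lambda>n. J (\<lambda>v. x n v + y n v)) \<longlonglongrightarrow> z + z'" using x(1) y(1) by (simp add: J_add)
  qed (use x y in \<open>auto intro: c00_add\<close>)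
qed

lemma subspace_off: "subspace (off A)"
proof (rule subspaceI)
  show "0 \<in> off A" by (rule offI[of "\<lambda>_ _. 0"]) (auto simp: J_zero c00_zero)
qed (auto intro: off_add off_scale)

text \<open>Coordinates are bounded by the norm (\<open>abs_le_T\<close>), so the v-coordinates of
  an approximating sequence converge; their limit is the coefficient c.\<close>

lemma off_insert_decomp:
  assumes z: "z \<in> off A" and v: "v \<in> nondec_eq k" "v \<notin> A"
  obtains c where "z - c *\<^sub>R J (\<lambda>u. if u = v then 1 else 0) \<in> off (insert v A)"
proof -
  let ?e = "\<lambda>u. if u = v then 1 else (0::real)"
  have e: "?e \<in> c00 k" using v by (simp add: c00_def)
  obtain x where "\<forall>n. x n \<in> c00 k" "\<forall>n. \<forall>v\<in>A. x n v = 0" "(\<lambda>n. J (x n)) \<longlonglongrightarrow> z"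
    using off_sequence[OF z] by (elim exE conjE)
  then have x: "\<And>n. x n \<in> c00 k" "\<And>n v. v \<in> A \<Longrightarrow> x n v = 0" "(\<lambda>n. J (x n)) \<longlonglongrightarrow> z"
    by blast+
  have "Cauchy (\<lambda>n. x n v)"
  proof (rule metric_CauchyI)
    fix \<epsilon> :: real assume "0 < \<epsilon>"
    then obtain N where N: "\<And>m n. m \<ge> N \<Longrightarrow> n \<ge> N \<Longrightarrow> dist (J (x m)) (J (x n)) < \<epsilon>"
      using metric_CauchyD[OF LIMSEQ_imp_Cauchy[OF x(3)]] by blast
    have "dist (x m v) (x n v) < \<epsilon>" if "m \<ge> N" "n \<ge> N" for m n
    proof -
      have "dist (x m v) (x n v) \<le> T (\<lambda>v. x m v - 1 * x n v)"
        using abs_le_T[OF c00_diff[OF x(1)[of m] x(1)[of n], of 1], of v] by (simp add: dist_real_def)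
      also have "\<dots> = dist (J (x m)) (J (x n))"
        using norm_J[OF c00_diff[OF x(1)[of m] x(1)[of n], of 1]] J_diff[OF x(1)[of m] x(1)[of n], of 1]
        by (simp add: dist_norm)
      finally show ?thesis using N[OF that] by linarith
    qed
    then show "\<exists>M. \<forall>m\<ge>M. \<forall>n\<ge>M. dist (x m v) (x n v) < \<epsilon>" by blast
  qed
  then obtain c where c: "(\<lambda>n. x n v) \<longlonglongrightarrow> c" using Cauchy_convergent_iff convergent_def by blast
  have "z - c *\<^sub>R J ?e \<in> off (insert v A)"
  proof (rule offI[of "\<lambda>n u. x n u - x n v * ?e u"])
    fix n
    show "(\<lambda>u. x n u - x n v * ?e u) \<in> c00 k" by (rule c00_diff[OF x(1) e])
    fix u assume "u \<in> insert v A"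
    then show "x n u - x n v * ?e u = 0" using x(2) by (cases "u = v") auto
  next
    have "(\<lambda>n. J (x n) - x n v *\<^sub>R J ?e) \<longlonglongrightarrow> z - c *\<^sub>R J ?e"
      using x(3) c by (intro tendsto_intros)
    then show "(\<lambda>n. J (\<lambda>u. x n u - x n v * ?e u)) \<longlonglongrightarrow> z - c *\<^sub>R J ?e"
      unfolding J_diff[OF x(1) e] .
  qed
  then show ?thesis by (rule that)
qed

text \<open>One more vanishing coordinate lowers the dimension by at most one: if some
  \<open>z0\<close> in Z has a non-zero coefficient at v, a multiple of it removes the v-coordinate
  of any other element; otherwise nothing has to be removed.\<close>

lemma infinite_dimensional_off_insert:
  assumes Z: "subspace Z" "infinite_dimensional Z" "Z \<subseteq> off A" and v: "v \<in> nondec_eq k" "v \<notin> A"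
  shows "infinite_dimensional (Z \<inter> off (insert v A))"
  unfolding infinite_dimensional_def
proof (intro notI, elim exE conjE)
  fix F assume F: "finite F" "Z \<inter> off (insert v A) \<subseteq> span F"
  let ?e = "J (\<lambda>u. if u = v then 1 else 0)"
  have dec: "\<exists>c. z - c *\<^sub>R ?e \<in> off (insert v A)" if z: "z \<in> Z" for z
    using off_insert_decomp[OF subsetD[OF Z(3) z] v] by blast
  show False
  proof (cases "\<exists>z0\<in>Z. \<exists>c\<noteq>0. z0 - c *\<^sub>R ?e \<in> off (insert v A)")
    case True
    then obtain z0 c0 where z0: "z0 \<in> Z" "c0 \<noteq> 0" "z0 - c0 *\<^sub>R ?e \<in> off (insert v A)" by blast
    have "z \<in> span (insert z0 F)" if z: "z \<in> Z" for z
    proof -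
      obtain c where c: "z - c *\<^sub>R ?e \<in> off (insert v A)" using dec[OF z] by blast
      have "(z - c *\<^sub>R ?e) - (c / c0) *\<^sub>R (z0 - c0 *\<^sub>R ?e) \<in> off (insert v A)"
        by (intro subspace_diff[OF subspace_off] subspace_scale[OF subspace_off] c z0)
      moreover have "(z - c *\<^sub>R ?e) - (c / c0) *\<^sub>R (z0 - c0 *\<^sub>R ?e) = z - (c / c0) *\<^sub>R z0"
        using z0(2) by (simp add: scaleR_diff_right)
      moreover have "z - (c / c0) *\<^sub>R z0 \<in> Z"
        by (intro subspace_diff[OF Z(1)] subspace_scale[OF Z(1)] z z0)
      ultimately have "z - (c / c0) *\<^sub>R z0 \<in> span F" using F by auto
      then have "z - (c / c0) *\<^sub>R z0 \<in> span (insert z0 F)"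
        using span_mono[of F "insert z0 F"] by auto
      moreover have "(c / c0) *\<^sub>R z0 \<in> span (insert z0 F)"
        by (intro span_scale span_base) simp
      ultimately have "(z - (c / c0) *\<^sub>R z0) + (c / c0) *\<^sub>R z0 \<in> span (insert z0 F)"
        by (rule span_add)
      then show ?thesis by simp
    qed
    then show False using Z(2) F(1) unfolding infinite_dimensional_def by (meson finite_insert subsetI)
  next
    case False
    have "z \<in> span F" if z: "z \<in> Z" for z
    proof -
      obtain c where c: "z - c *\<^sub>R ?e \<in> off (insert v A)" using dec[OF z] by blast
      then have "c = 0" using False z by blast
      then have "z \<in> off (insert v A)" using c by simp
      then show ?thesis using F z by blast
    qed
    then show False using Z(2) F(1) unfolding infinite_dimensional_def by blast
  qed
qed

lemma infinite_dimensional_off: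
  assumes Z: "subspace Z" "infinite_dimensional Z" "Z \<subseteq> TT"
  shows "finite A \<Longrightarrow> A \<subseteq> nondec_eq k \<Longrightarrow> infinite_dimensional (Z \<inter> off A)"
proof (induction A rule: finite_induct)
  case empty
  then show ?case using Z by (simp add: off_empty Int_absorb2)
next
  case (insert v A)
  have "infinite_dimensional ((Z \<inter> off A) \<inter> off (insert v A))"
    using insert by (intro infinite_dimensional_off_insert subspace_inter Z(1) subspace_off) auto
  moreover have "(Z \<inter> off A) \<inter> off (insert v A) = Z \<inter> off (insert v A)"
    using off_antimono[of A "insert v A"] by blast
  ultimately show ?case by simp
qed

section \<open>The gliding hump argument\<close>

lemma finite_last_less: "finite {v \<in> nondec_eq k. last v < M}"
\<comment> \<open>All these lists precede the one-element list \<open>[M]\<close>.\<close>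
proof (rule finite_subset[OF _ finite_prec[of k "[M]"]])
  show "{v \<in> nondec_eq k. last v < M} \<subseteq> {t \<in> nondec_le k. prec t [M]}"
    using k by (auto simp: nondec_eq_def nondec_le_def prec_def)
qed

text \<open>Only finitely many coordinates end below M, so Z contains a non-zero element of
  \<open>off\<close> for them, and its approximations vanish there.\<close>

lemma hump:
  assumes Z: "subspace Z" "infinite_dimensional Z" "Z \<subseteq> TT" and \<epsilon>: "0 < \<epsilon>"
  shows "\<exists>z x. z \<in> Z \<and> norm z = 1 \<and> x \<in> c00 k \<and> (\<forall>v. x v \<noteq> 0 \<longrightarrow> M \<le> last v) \<and> norm (z - J x) < \<epsilon>"
proof -
  let ?A = "{v \<in> nondec_eq k. last v < M}"
  have "infinite_dimensional (Z \<inter> off ?A)"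
    by (rule infinite_dimensional_off[OF Z finite_last_less]) auto
  then have "\<not> Z \<inter> off ?A \<subseteq> {0}"
    unfolding infinite_dimensional_def using span_empty finite.emptyI by metis
  then obtain z0 where z0: "z0 \<in> Z" "z0 \<in> off ?A" "z0 \<noteq> 0" by blast
  define z where "z = (1 / norm z0) *\<^sub>R z0"
  have z: "z \<in> Z" "z \<in> off ?A" "norm z = 1"
    using z0 Z(1) by (auto simp: z_def intro: subspace_scale off_scale)
  obtain x where "\<forall>n. x n \<in> c00 k" "\<forall>n. \<forall>v\<in>?A. x n v = 0" "(\<lambda>n. J (x n)) \<longlonglongrightarrow> z"
    using off_sequence[OF z(2)] by (elim exE conjE)
  then have x: "\<And>n. x n \<in> c00 k" "\<And>n v. v \<in> ?A \<Longrightarrow> x n v = 0" "(\<lambda>n. J (x n)) \<longlonglongrightarrow> z"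
    by blast+
  obtain n where n: "dist (J (x n)) z < \<epsilon>" using metric_LIMSEQ_D[OF x(3) \<epsilon>] by blast
  have "M \<le> last v" if "x n v \<noteq> 0" for v
  proof -
    have "v \<in> nondec_eq k" using c00_eq_0[OF x(1)] that by blast
    then show ?thesis using x(2)[of v n] that by fastforce
  qed
  then show ?thesis using z x(1) n by (intro exI[of _ z] exI[of _ "x n"]) (auto simp: dist_norm norm_minus_commute)
qed

text \<open>Each new bound is chosen beyond the support of the previous vector. The errors are
  summable, so that replacing x by z will be a small perturbation.\<close>

lemma block_sequence:
  assumes Z: "subspace Z" "infinite_dimensional Z" "Z \<subseteq> TT"
  obtains M :: "nat \<Rightarrow> nat" and z x where "strict_mono M" "\<And>n. z n \<in> Z" "\<And>n. norm (z n) = 1"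
    "\<And>n. x n \<in> c00 k" "\<And>n v. x n v \<noteq> 0 \<Longrightarrow> M n \<le> last v \<and> last v < M (Suc n)"
    "\<And>n. norm (z n - J (x n)) < (1 / 2) ^ Suc n"
proof -
  define P where "P n s = (case s of (M, z, x) \<Rightarrow> z \<in> Z \<and> norm z = 1 \<and> x \<in> c00 k \<and>
    (\<forall>v. x v \<noteq> 0 \<longrightarrow> M \<le> last v) \<and> norm (z - J x) < (1 / 2) ^ Suc n)" for n :: nat and s :: "nat \<times> 'b \<times> (nat list \<Rightarrow> real)"
  define Q where "Q n s s' = (case s of (M, z, x) \<Rightarrow> case s' of (M', z', x') \<Rightarrow>
    M < M' \<and> (\<forall>v. x v \<noteq> 0 \<longrightarrow> last v < M'))" for n :: nat and s s' :: "nat \<times> 'b \<times> (nat list \<Rightarrow> real)"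
  have ex: "\<exists>z x. P n (M, z, x)" for n M
    unfolding P_def prod.case by (rule hump[OF Z]) simp
  have "\<exists>f. \<forall>n. P n (f n) \<and> Q n (f n) (f (Suc n))"
  proof (rule dependent_nat_choice)
    show "\<exists>s. P 0 s" using ex by blast
    fix s n assume "P n s"
    obtain M z x where s: "s = (M, z, x)" by (cases s)
    then have "x \<in> c00 k" using \<open>P n s\<close> by (simp add: P_def)
    then obtain B where B: "\<And>v. x v \<noteq> 0 \<Longrightarrow> last v < B" using c00_last_bound by blast
    obtain z' x' where "P (Suc n) (max B (Suc M), z', x')" using ex by blast
    moreover have "Q n s (max B (Suc M), z', x')" using B by (auto simp: Q_def s less_max_iff_disj)
    ultimately show "\<exists>s'. P (Suc n) s' \<and> Q n s s'" by blast
  qed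
  then obtain f where f: "\<And>n. P n (f n)" "\<And>n. Q n (f n) (f (Suc n))" by blast
  define M where "M n = fst (f n)" for n
  define z where "z n = fst (snd (f n))" for n
  define x where "x n = snd (snd (f n))" for n
  have fe: "f n = (M n, z n, x n)" for n by (simp add: M_def z_def x_def)
  have P: "z n \<in> Z" "norm (z n) = 1" "x n \<in> c00 k" "\<And>v. x n v \<noteq> 0 \<Longrightarrow> M n \<le> last v"
    "norm (z n - J (x n)) < (1 / 2) ^ Suc n" for n
    using f(1)[of n] by (auto simp: P_def fe)
  have Q: "M n < M (Suc n)" "\<And>v. x n v \<noteq> 0 \<Longrightarrow> last v < M (Suc n)" for n
    using f(2)[of n] by (auto simp: Q_def fe)
  show ?thesis
    by (rule that[of M z x]) (use P Q in \<open>auto simp: strict_mono_Suc_iff\<close>)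
qed

end

text \<open>Used at one fixed coordinate, where at most one block is non-zero: restricting blocks
  and omitting some of them then gives the pointwise domination that \<open>T_mono\<close>
  needs.\<close>

lemma abs_sum_disjoint_mono:
  fixes f g :: "'a \<Rightarrow> real"
  assumes B: "finite B" and AB: "A \<subseteq> B" and f: "\<And>i. i \<in> A \<Longrightarrow> f i = 0 \<or> f i = g i"
    and uniq: "\<And>i j. g i \<noteq> 0 \<Longrightarrow> g j \<noteq> 0 \<Longrightarrow> i = j"
  shows "\<bar>\<Sum>i\<in>A. f i\<bar> \<le> \<bar>\<Sum>i\<in>B. g i\<bar>"
proof (cases "\<exists>i\<in>A. f i \<noteq> 0")
  case True
  then obtain i where i: "i \<in> A" "f i \<noteq> 0" by blast
  then have fi: "f i = g i" and gi: "g i \<noteq> 0" using f[of i] by auto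
  have "g j = 0" if "j \<noteq> i" for j using uniq[OF gi, of j] that by blast
  moreover from this have "f j = 0" if "j \<in> A" "j \<noteq> i" for j using f[OF that(1)] that(2) by auto
  ultimately have "(\<Sum>j\<in>A - {i}. f j) = 0" "(\<Sum>j\<in>B - {i}. g j) = 0"
    by (auto intro: sum.neutral)
  moreover have "finite A" "i \<in> B" using AB B i finite_subset by auto
  ultimately show ?thesis using i B fi by (simp add: sum.remove)
qed (simp add: sum.neutral)

section \<open>The node above which the blocks stay large\<close>

context T_space
begin

text \<open>By maximality of \<open>s\<close> the restrictions to each child of \<open>s\<close>
  tend to 0. So the finitely many children with next entry below N can be removed, for any N, at the
  cost of half of \<delta> for large i.\<close>

lemma stable_node:
  fixes x :: "nat \<Rightarrow> nat list \<Rightarrow> real" and M :: "nat \<Rightarrow> nat"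
  assumes x: "\<And>n. x n \<in> c00 k" and T1: "\<And>n. 1 / 2 \<le> T (x n)"
    and M: "strict_mono M" "\<And>n v. x n v \<noteq> 0 \<Longrightarrow> M n \<le> last v"
  obtains s \<delta> where "sorted s" "length s < k" "0 < \<delta>"
    "\<And>N i0. \<exists>i>i0. \<delta> \<le> T (proj {v. prefix s v \<and> N \<le> v ! length s} (x i))"
proof -
  define P where "P s i = proj {v. prefix s v} (x i)" for s i
  have P: "P s i \<in> c00 k" for s i unfolding P_def by (intro proj_c00 x)
  define S where "S = {s. \<not> (\<lambda>i. T (P s i)) \<longlonglongrightarrow> 0}"
  have "[] \<in> S"
  proof -
    have "P [] i = x i" for i by (simp add: P_def proj_def)
    then have "\<not> (\<lambda>i. T (P [] i)) \<longlonglongrightarrow> 0"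
      using T1 LIMSEQ_le_const[of "\<lambda>i. T (x i)" 0 "1/2"] by auto
    then show ?thesis by (simp add: S_def)
  qed
  have len: "length s < k" if "s \<in> S" for s
  proof (rule ccontr)
    assume s: "\<not> length s < k"
    \<comment> \<open>At most one coordinate, \<open>s\<close> itself, lies above a node of length
      at least k, and the blocks leave it because i \<le> \<open>M i\<close> \<le>
      \<open>last v\<close> on the support of \<open>x i\<close>.\<close>
    have "P s i = (\<lambda>v. 0)" if i: "last s < i" for i
    proof
      fix v
      have "v = s" if "x i v \<noteq> 0" "prefix s v"
      proof -
        have "v \<in> nondec_eq k" using c00_eq_0[OF x] that by blast
        then show ?thesis using s that(2) by (auto simp: nondec_eq_def prefix_def)
      qed
      moreover have "last v \<noteq> last s" if "x i v \<noteq> 0"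
        using M(2)[OF that] strict_mono_imp_increasing[OF M(1), of i] i by linarith
      ultimately show "P s i v = 0" by (auto simp: P_def proj_def)
    qed
    then have "\<forall>\<^sub>F i in sequentially. T (P s i) = 0"
      by (intro eventually_sequentiallyI[of "Suc (last s)"]) (simp add: T_zero)
    then have "(\<lambda>i. T (P s i)) \<longlonglongrightarrow> 0" by (rule tendsto_eventually)
    then show False using that by (simp add: S_def)
  qed
  have "\<exists>l. (\<exists>s\<in>S. length s = l) \<and> (\<forall>l'. (\<exists>s\<in>S. length s = l') \<longrightarrow> l' \<le> l)"
    by (rule Nat.ex_has_greatest_nat[of _ 0 k]) (use \<open>[] \<in> S\<close> len in \<open>auto intro: less_imp_le\<close>)
  then obtain s where s: "s \<in> S" and max: "\<And>s'. s' \<in> S \<Longrightarrow> length s' \<le> length s" by blast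
  have sk: "length s < k" by (rule len[OF s])
  have ext: "(\<lambda>i. T (P (s @ [n]) i)) \<longlonglongrightarrow> 0" for n
    using max[of "s @ [n]"] by (auto simp: S_def)
  from s obtain \<delta> where \<delta>: "0 < \<delta>" "\<And>i0. \<exists>i\<ge>i0. \<delta> \<le> T (P s i)"
    using T_nonneg[OF P] by (auto simp: S_def LIMSEQ_iff not_less)
  have "sorted s"
  proof -
    obtain i where "\<delta> \<le> T (P s i)" using \<delta>(2) by blast
    then have "P s i \<noteq> (\<lambda>v. 0)" using \<delta>(1) T_zero by auto
    then obtain v where v: "P s i v \<noteq> 0" by blast
    then have "prefix s v" by (auto simp: P_def proj_def split: if_splits)
    moreover have "v \<in> nondec_eq k" using c00_eq_0[OF P] v by blast
    ultimately show ?thesis by (auto simp: nondec_eq_def prefix_def sorted_append)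
  qed
  moreover have "\<exists>i>i0. \<delta> / 2 \<le> T (proj {v. prefix s v \<and> N \<le> v ! length s} (x i))" for N i0
  proof -
    let ?R = "\<lambda>i. proj {v. prefix s v \<and> N \<le> v ! length s} (x i)"
    have "(\<lambda>i. \<Sum>n<N. T (P (s @ [n]) i)) \<longlonglongrightarrow> (\<Sum>n<N. 0)" by (intro tendsto_sum ext)
    then have "\<forall>\<^sub>F i in sequentially. (\<Sum>n<N. T (P (s @ [n]) i)) < \<delta> / 2"
      using \<delta>(1) by (intro order_tendstoD) auto
    then obtain i1 where i1: "\<And>i. i \<ge> i1 \<Longrightarrow> (\<Sum>n<N. T (P (s @ [n]) i)) < \<delta> / 2"
      unfolding eventually_sequentially by blast
    obtain i where i: "i \<ge> max i1 (Suc i0)" "\<delta> \<le> T (P s i)" using \<delta>(2) by blast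
    \<comment> \<open>Each coordinate above \<open>s\<close> passes through exactly one child; the
      children are split at N.\<close>
    have "P s i = (\<lambda>v. ?R i v + (\<Sum>n<N. P (s @ [n]) i v))"
    proof
      fix v
      show "P s i v = ?R i v + (\<Sum>n<N. P (s @ [n]) i v)"
      proof (cases "x i v \<noteq> 0 \<and> prefix s v")
        case True
        then have "v \<in> nondec_eq k" using c00_eq_0[OF x] by blast
        moreover obtain u where u: "v = s @ u" using True by (auto simp: prefix_def)
        ultimately obtain m w where v: "v = s @ m # w" using sk by (cases u) (auto simp: nondec_eq_def)
        have "P (s @ [n]) i v = (if n = m then x i v else 0)" for n
          by (auto simp: P_def proj_def v)
        then have "(\<Sum>n<N. P (s @ [n]) i v) = (if m < N then x i v else 0)" by simp
        moreover have "?R i v = (if N \<le> m then x i v else 0)" by (simp add: proj_def v)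
        moreover have "P s i v = x i v" using True by (simp add: P_def proj_def)
        ultimately show ?thesis by simp
      next
        case False
        then have "P (s @ [n]) i v = 0" for n
          by (auto simp: P_def proj_def dest: append_prefixD)
        then show ?thesis using False by (auto simp: P_def proj_def)
      qed
    qed
    then have "T (P s i) = T (\<lambda>v. ?R i v + (\<Sum>n<N. P (s @ [n]) i v))" by simp
    also have "\<dots> \<le> T (?R i) + T (\<lambda>v. \<Sum>n<N. P (s @ [n]) i v)"
      using P x by (intro T_add_le proj_c00 c00_sum) auto
    also have "T (\<lambda>v. \<Sum>n<N. P (s @ [n]) i v) \<le> (\<Sum>n<N. T (P (s @ [n]) i))"
      using P by (intro T_sum_le) auto
    finally have "\<delta> / 2 \<le> T (?R i)" using i i1[of i] by linarith
    then show ?thesis using i(1) by (intro exI[of _ i]) auto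
  qed
  ultimately show ?thesis using sk \<delta>(1) by (intro that[of s "\<delta> / 2"]) auto
qed

end

section \<open>The subsequence and its two-sided estimate\<close>

context T_space
begin

lemma lp_subspace_of_blocks:
  fixes x :: "nat \<Rightarrow> nat list \<Rightarrow> real" and M :: "nat \<Rightarrow> nat"
  assumes p: "1 < p" and \<theta>d: "\<theta> * real d powr (1 - 1 / p) = 1" and d2: "2 \<le> d"
    and Z: "subspace Z" "closed Z" and z: "\<And>n. z n \<in> Z"
    and M: "strict_mono M" and x: "\<And>n. x n \<in> c00 k" and x2: "\<And>n. T (x n) \<le> 2"
    and supp: "\<And>n v. x n v \<noteq> 0 \<Longrightarrow> M n \<le> last v \<and> last v < M (Suc n)"
    and close: "\<And>n. norm (z n - J (x n)) < (1 / 2) ^ Suc n"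
    and s: "sorted s" "length s < k" and \<delta>: "0 < \<delta>"
    and node: "\<And>N i0. \<exists>i>i0. \<delta> \<le> T (proj {v. prefix s v \<and> N \<le> v ! length s} (x i))"
  shows "\<exists>Y. Y \<subseteq> Z \<and> subspace Y \<and> closed Y \<and> isomorphic_to_lp p Y"
proof (rule T_block_upper[OF p \<theta>d])
  fix C :: real
  assume C: "0 < C" and upper_C: "\<And>I x b. finite I \<Longrightarrow> (\<And>i. i \<in> I \<Longrightarrow> x i \<in> c00 k) \<Longrightarrow>
      (\<And>i. i \<in> I \<Longrightarrow> T (x i) \<le> b i) \<Longrightarrow>
      (\<And>i i' v v'. i \<in> I \<Longrightarrow> i' \<in> I \<Longrightarrow> i < i' \<Longrightarrow> x i v \<noteq> 0 \<Longrightarrow> x i' v' \<noteq> 0 \<Longrightarrow> prec v v') \<Longrightarrow>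
      T (\<lambda>v. \<Sum>i\<in>(I :: nat set). x i v) \<le> C * pnorm p b I"
  have p0: "0 < p" using p by simp
  define K where "K = (1 / (2 * real d)) powr (1 - 1 / p)"
  define \<kappa> where "\<kappa> = K * \<delta>"
  have \<kappa>: "0 < \<kappa>" using \<delta> d2 by (simp add: \<kappa>_def K_def)
  obtain n1 :: nat where n1: "(1 / 2) ^ n1 < \<kappa> / 2" using real_arch_pow_inv[of "\<kappa> / 2" "1 / 2"] \<kappa> by auto
  \<comment> \<open>\<open>n1\<close> makes the total perturbation at most half of the lower
    constant; \<open>sum_list s\<close> bounds the entries of \<open>s\<close>, which must not
    exceed \<open>N 0\<close>.\<close>
  define n0 where "n0 = max n1 (sum_list s)"
  have "(1 / 2 :: real) ^ n0 \<le> (1 / 2) ^ n1" by (rule power_decreasing) (auto simp: n0_def)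
  then have n0: "(1 / 2) ^ n0 \<le> \<kappa> / 2" using n1 by linarith
  have "\<forall>i. \<exists>i'. i < i' \<and> \<delta> \<le> T (proj {v. prefix s v \<and> M (Suc i) \<le> v ! length s} (x i'))"
    using node by blast
  from choice[OF this] obtain h
    where h: "\<forall>i. i < h i \<and> \<delta> \<le> T (proj {v. prefix s v \<and> M (Suc i) \<le> v ! length s} (x (h i)))" ..
  \<comment> \<open>The index shift is deliberate: the block \<open>x (g (Suc i))\<close> is
    restricted to next entries at or beyond \<open>M (Suc (g i))\<close>, the bound for the support
    of \<open>x (g i)\<close>. Thus \<open>y i\<close> lives between \<open>N i\<close> and
    \<open>N (Suc i)\<close>, as \<open>T_superadditive\<close> requires.\<close>
  define g where "g i = (h ^^ i) n0" for i
  define \<sigma> where "\<sigma> i = g (Suc i)" for i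
  define N where "N i = M (Suc (g i))" for i
  define y where "y i = proj {v. prefix s v \<and> N i \<le> v ! length s} (x (\<sigma> i))" for i
  have g: "strict_mono g" using h by (simp add: strict_mono_Suc_iff g_def)
  have N: "strict_mono N" using strict_monoD[OF M] strict_monoD[OF g] by (simp add: strict_mono_def N_def)
  have g_ge: "n0 + i \<le> g i" for i
  proof (induction i)
    case (Suc i)
    then show ?case using strict_monoD[OF g, of i "Suc i"] by simp
  qed (simp add: g_def)
  have y: "y i \<in> c00 k" for i unfolding y_def by (intro proj_c00 x)
  have y\<delta>: "\<delta> \<le> T (y i)" for i using h by (simp add: y_def \<sigma>_def N_def g_def)
  have y_supp: "prefix s v \<and> N i \<le> v ! length s \<and> last v < N (Suc i)" if "y i v \<noteq> 0" for i v
    using that supp[of "\<sigma> i" v] by (auto simp: y_def proj_def N_def \<sigma>_def split: if_splits)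
  have uniq: "i = j" if "x (\<sigma> i) v \<noteq> 0" "x (\<sigma> j) v \<noteq> 0" for i j v
  proof -
    have "M (\<sigma> i) < M (Suc (\<sigma> j))" "M (\<sigma> j) < M (Suc (\<sigma> i))"
      using supp[OF that(1)] supp[OF that(2)] by linarith+
    then have "\<sigma> i = \<sigma> j" using M by (simp add: strict_mono_less)
    then show ?thesis using g by (simp add: \<sigma>_def strict_mono_eq)
  qed
  have sN: "\<forall>x\<in>set s. x \<le> N 0"
  proof
    fix u assume "u \<in> set s"
    then have "u \<le> sum_list s" by (intro member_le_sum_list) auto
    also have "\<dots> \<le> Suc (g 0)" using g_ge[of 0] by (simp add: n0_def)
    also have "\<dots> \<le> N 0" unfolding N_def using M by (rule strict_mono_imp_increasing)
    finally show "u \<le> N 0" .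
  qed
  have lower: "\<kappa> * pnorm p a I \<le> T (\<lambda>v. \<Sum>i\<in>I. a i * x (\<sigma> i) v)" if I: "finite I" for I a
  proof -
    define \<phi> where "\<phi> A = T (\<lambda>v. \<Sum>i\<in>A. a i * y i v)" for A
    have ay: "(\<lambda>v. a i * y i v) \<in> c00 k" for i using y by (rule c00_cmult)
    have cs: "(\<lambda>v. \<Sum>i\<in>A. a i * y i v) \<in> c00 k" if "finite A" for A
      using that ay by (rule c00_sum)
    have le: "\<bar>\<Sum>i\<in>A. a i * y i v\<bar> \<le> \<bar>\<Sum>i\<in>B. a i * f i v\<bar>"
      if "finite B" "A \<subseteq> B" "f = y \<or> f = (\<lambda>i. x (\<sigma> i))" for A B v f
    proof (rule abs_sum_disjoint_mono[OF that(1,2)])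
      show "a i * y i v = 0 \<or> a i * y i v = a i * f i v" for i
        using that(3) by (auto simp: y_def proj_def)
      fix i j assume "a i * f i v \<noteq> 0" "a j * f j v \<noteq> 0"
      then have "x (\<sigma> i) v \<noteq> 0" "x (\<sigma> j) v \<noteq> 0"
        using that(3) by (auto simp: y_def proj_def split: if_splits)
      then show "i = j" by (rule uniq)
    qed
    \<comment> \<open>The factor \<delta> is carried in the coefficients, since a single restricted
      block has norm at least \<delta> only.\<close>
    have "K * pnorm p (\<lambda>i. \<delta> * a i) I \<le> \<phi> I"
      unfolding K_def
    proof (rule pnorm_le_superadditive[where \<theta> = \<theta>])
      show "0 \<le> \<phi> {}" by (simp add: \<phi>_def T_zero)
      show "\<phi> A \<le> \<phi> B" if "A \<subseteq> B" "B \<subseteq> I" for A B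
      proof -
        have B: "finite B" using that(2) I by (rule finite_subset)
        have A: "finite A" using that(1) B by (rule finite_subset)
        show ?thesis
          unfolding \<phi>_def by (rule T_mono[OF cs[OF A] cs[OF B]], rule le[OF B that(1)], rule disjI1, rule refl)
      qed
      show "\<bar>\<delta> * a i\<bar> \<le> \<phi> {i}" for i
        using mult_right_mono[OF y\<delta>[of i], of "\<bar>a i\<bar>"] \<delta> by (simp add: \<phi>_def T_cmult y abs_mult mult.commute)
      fix f :: "nat \<Rightarrow> nat set"
      assume fI: "\<And>l. l < d \<Longrightarrow> f l \<subseteq> I"
        and ord: "\<And>l l' i i'. l < l' \<Longrightarrow> l' < d \<Longrightarrow> i \<in> f l \<Longrightarrow> i' \<in> f l' \<Longrightarrow> i < i'"
      have "(\<Union>l<d. f l) \<subseteq> I" using fI by blast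
      then have fin: "finite (\<Union>l<d. f l)" using I by (rule finite_subset)
      show "\<theta> * (\<Sum>l<d. \<phi> (f l)) \<le> \<phi> (\<Union>l<d. f l)"
        unfolding \<phi>_def
      proof (rule T_superadditive[OF s(1) sN s(2) N ay _ fin _ ord])
        fix i v assume "a i * y i v \<noteq> 0"
        then have "y i v \<noteq> 0" by simp
        then show "prefix s v \<and> N i \<le> v ! length s \<and> last v < N (Suc i)" by (rule y_supp)
      next
        fix l assume "l < d"
        then show "f l \<subseteq> (\<Union>l<d. f l)" by blast
      qed
    next
      show "1 < p" "2 \<le> d" "0 < \<theta>" "\<theta> \<le> 1" "\<theta> * real d powr (1 - 1 / p) = 1" "finite I"
        using p d2 \<theta> \<theta>d I by simp_all
    qed
    also have "\<phi> I \<le> T (\<lambda>v. \<Sum>i\<in>I. a i * x (\<sigma> i) v)"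
      unfolding \<phi>_def
    proof (rule T_mono[OF cs[OF I]])
      show "(\<lambda>v. \<Sum>i\<in>I. a i * x (\<sigma> i) v) \<in> c00 k" using I x by (intro c00_sum c00_cmult)
      show "\<bar>\<Sum>i\<in>I. a i * y i v\<bar> \<le> \<bar>\<Sum>i\<in>I. a i * x (\<sigma> i) v\<bar>" for v
        using I by (intro le[where f = "\<lambda>i. x (\<sigma> i)"]) simp_all
    qed
    finally show ?thesis using p0 \<delta> by (simp add: \<kappa>_def pnorm_cmult)
  qed
  have upper: "T (\<lambda>v. \<Sum>i\<in>I. a i * x (\<sigma> i) v) \<le> 2 * C * pnorm p a I" if I: "finite I" for I a
  proof -
    have "T (\<lambda>v. \<Sum>i\<in>I. a i * x (\<sigma> i) v) \<le> C * pnorm p (\<lambda>i. 2 * a i) I"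
    proof (rule order_trans[OF upper_C[where b = "\<lambda>i. \<bar>2 * a i\<bar>"]])
      show "T (\<lambda>v. a i * x (\<sigma> i) v) \<le> \<bar>2 * a i\<bar>" for i
        using mult_left_mono[OF x2[of "\<sigma> i"], of "\<bar>a i\<bar>"] by (simp add: T_cmult x abs_mult mult.commute)
      fix i i' v v' assume i: "i < i'" "a i * x (\<sigma> i) v \<noteq> 0" "a i' * x (\<sigma> i') v' \<noteq> 0"
      then have "last v < M (Suc (\<sigma> i))" "M (\<sigma> i') \<le> last v'" using supp by auto
      moreover have "M (Suc (\<sigma> i)) \<le> M (\<sigma> i')"
        using M strict_monoD[OF g, of "Suc i" "Suc i'"] i by (simp add: strict_mono_less_eq \<sigma>_def)
      moreover have "v \<in> nondec_eq k" "v' \<in> nondec_eq k" using c00_eq_0[OF x] i by auto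
      then have "v \<noteq> []" "v' \<noteq> []" using k by (auto simp: nondec_eq_def)
      ultimately show "prec v v'" by (intro prec_lastI) auto
    qed (auto simp: I pnorm_def intro!: c00_cmult x)
    then show ?thesis using p0 by (simp add: pnorm_cmult)
  qed
  have near: "norm ((\<Sum>i\<in>I. a i *\<^sub>R z (\<sigma> i)) - J (\<lambda>v. \<Sum>i\<in>I. a i * x (\<sigma> i) v)) \<le> \<kappa> / 2 * pnorm p a I"
    if I: "finite I" for I a
  proof -
    have "(\<Sum>i\<in>I. a i *\<^sub>R z (\<sigma> i)) - J (\<lambda>v. \<Sum>i\<in>I. a i * x (\<sigma> i) v)
        = (\<Sum>i\<in>I. a i *\<^sub>R (z (\<sigma> i) - J (x (\<sigma> i))))"
      by (simp add: J_sum I x sum_subtractf scaleR_diff_right)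
    also have "norm \<dots> \<le> (\<Sum>i\<in>I. \<bar>a i\<bar> * norm (z (\<sigma> i) - J (x (\<sigma> i))))"
      by (rule order_trans[OF norm_sum]) simp
    \<comment> \<open>Every coefficient is at most the p-norm, and \<open>\<sigma> i\<close> is at
      least \<open>n0 + Suc i\<close>, so the errors form a geometric series.\<close>
    also have "\<dots> \<le> (\<Sum>i\<in>I. pnorm p a I * ((1 / 2) ^ n0 * (1 / 2) ^ Suc i))"
    proof (rule sum_mono)
      fix i assume i: "i \<in> I"
      have "norm (z (\<sigma> i) - J (x (\<sigma> i))) \<le> (1 / 2) ^ Suc (\<sigma> i)" using close by (rule less_imp_le)
      also have "\<dots> \<le> (1 / 2) ^ (n0 + Suc i)"
        using g_ge[of "Suc i"] by (intro power_decreasing) (auto simp: \<sigma>_def)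
      also have "\<dots> = (1 / 2) ^ n0 * (1 / 2) ^ Suc i" by (rule power_add)
      finally show "\<bar>a i\<bar> * norm (z (\<sigma> i) - J (x (\<sigma> i))) \<le> pnorm p a I * ((1 / 2) ^ n0 * (1 / 2) ^ Suc i)"
        using abs_le_pnorm[OF p0 I i] by (intro mult_mono) auto
    qed
    also have "\<dots> = pnorm p a I * (1 / 2) ^ n0 * (\<Sum>i\<in>I. (1 / 2) ^ Suc i)"
      by (simp only: sum_distrib_left mult.assoc)
    also have "\<dots> \<le> pnorm p a I * (1 / 2) ^ n0 * 1"
    proof (intro mult_left_mono)
      show "(\<Sum>i\<in>I. (1 / 2 :: real) ^ Suc i) \<le> 1"
        using sum_le_suminf[OF sums_summable[OF power_half_series] I] sums_unique[OF power_half_series] by simp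
    qed simp
    also have "\<dots> \<le> \<kappa> / 2 * pnorm p a I"
      using mult_left_mono[OF n0, of "pnorm p a I"] by (simp add: mult.commute)
    finally show ?thesis .
  qed
  have normJ: "norm (J (\<lambda>v. \<Sum>i\<in>I. a i * x (\<sigma> i) v)) = T (\<lambda>v. \<Sum>i\<in>I. a i * x (\<sigma> i) v)"
    if "finite I" for I a
    using that x by (intro norm_J c00_sum c00_cmult)
  show ?thesis
  \<comment> \<open>The perturbation takes away half of the lower constant \<kappa> and adds as much
    to the upper constant 2 C.\<close>
  proof (rule lp_isomorphism[where z = "\<lambda>i. z (\<sigma> i)" and c = "\<kappa> / 2" and C = "2 * C + \<kappa> / 2"])
    fix I :: "nat set" and a assume I: "finite I"
    let ?z = "\<Sum>i\<in>I. a i *\<^sub>R z (\<sigma> i)" and ?x = "J (\<lambda>v. \<Sum>i\<in>I. a i * x (\<sigma> i) v)"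
    have "norm ?x \<le> norm ?z + norm (?z - ?x)" "norm ?z \<le> norm ?x + norm (?z - ?x)"
      using norm_triangle_ineq2[of ?x ?z] norm_triangle_ineq2[of ?z ?x] by (auto simp: norm_minus_commute)
    then show "\<kappa> / 2 * pnorm p a I \<le> norm ?z" "norm ?z \<le> (2 * C + \<kappa> / 2) * pnorm p a I"
      using near[OF I, of a] lower[OF I, of a] upper[OF I, of a] normJ[OF I, of a]
      by (simp_all add: distrib_right)
  qed (use p \<kappa> Z z in auto)
qed

lemma lp_subspace:
  assumes p: "1 < p" and \<theta>d: "\<theta> * real d powr (1 - 1 / p) = 1" and d2: "2 \<le> d"
    and Z: "subspace Z" "closed Z" "infinite_dimensional Z" "Z \<subseteq> TT"
  shows "\<exists>Y. Y \<subseteq> Z \<and> subspace Y \<and> closed Y \<and> isomorphic_to_lp p Y"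
proof (rule block_sequence[OF Z(1,3,4)])
  fix M :: "nat \<Rightarrow> nat" and z and x :: "nat \<Rightarrow> nat list \<Rightarrow> real"
  assume M: "strict_mono M" and z: "\<And>n. z n \<in> Z" "\<And>n. norm (z n) = 1" and x: "\<And>n. x n \<in> c00 k"
    and supp: "\<And>n v. x n v \<noteq> 0 \<Longrightarrow> M n \<le> last v \<and> last v < M (Suc n)"
    and close: "\<And>n. norm (z n - J (x n)) < (1 / 2) ^ Suc n"
  have T: "1 / 2 \<le> T (x n)" "T (x n) \<le> 2" for n
  proof -
    have "(1 / 2 :: real) ^ n \<le> 1" by (rule power_le_one) auto
    then have "norm (z n - J (x n)) \<le> 1 / 2" using close[of n] by simp
    moreover have "norm (z n) \<le> norm (J (x n)) + norm (z n - J (x n))"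
      "norm (J (x n)) \<le> norm (z n) + norm (z n - J (x n))"
      using norm_triangle_ineq2[of "z n" "J (x n)"] norm_triangle_ineq2[of "J (x n)" "z n"]
      by (auto simp: norm_minus_commute)
    ultimately show "1 / 2 \<le> T (x n)" "T (x n) \<le> 2" using z(2)[of n] norm_J[OF x[of n]] by auto
  qed
  show ?thesis
  proof (rule stable_node[OF x T(1) M])
    show "M n \<le> last v" if "x n v \<noteq> 0" for n v using supp[OF that] by blast
    fix s :: "nat list" and \<delta> :: real
    assume s: "sorted s" "length s < k" "0 < \<delta>"
      and node: "\<And>N i0. \<exists>i>i0. \<delta> \<le> T (proj {v. prefix s v \<and> N \<le> v ! length s} (x i))"
    show ?thesis
      by (rule lp_subspace_of_blocks[where z = z and x = x and M = M and s = s and \<delta> = \<delta>])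
        (fact p \<theta>d d2 Z(1,2) z(1) M x T(2) supp close s node)+
  qed
qed

end

theorem theorem6p2:
  fixes k d :: nat and \<theta> p :: real
    and J :: "(nat list \<Rightarrow> real) \<Rightarrow> 'b::banach" and T Z :: "'b set"
  assumes "k \<ge> 2" and "d \<ge> 1"
    and "0 < \<theta>" and "\<theta> < 1" and "real d * \<theta> > 1"
    and "1 < p" and "real d * \<theta> = real d powr (1 / p)"
    and "is_T_space k d \<theta> J T"
    and "Z \<subseteq> T" and "subspace Z" and "closed Z" and "infinite_dimensional Z"
  shows "\<exists>Y. Y \<subseteq> Z \<and> subspace Y \<and> closed Y \<and> isomorphic_to_lp p Y"
proof -
  interpret T_space k d \<theta> J T
    using assms by unfold_locales auto
  have "d \<noteq> 1" using assms(4,5) by auto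
  then have d2: "2 \<le> d" using assms(2) by simp
  \<comment> \<open>The defining relation of p in the form in which the weights use it.\<close>
  have "\<theta> * real d powr (1 - 1 / p) = real d * \<theta> / real d powr (1 / p)"
    using d2 by (simp add: powr_diff)
  also have "\<dots> = 1" unfolding assms(7) using d2 by simp
  finally show ?thesis using assms d2 by (intro lp_subspace)
qed

end
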